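(* Let $R$ be an arbitrary range. There exists a non-adaptive, one-sided $O(\varepsilon^{-1}n\log k)$-query $c$-Lipschitz tester for functions $f:[k]^n\to R$. The constant hidden in $O(\cdot)$ does not depend on $n,k,\varepsilon,c$ or $R$.
   Context: $[k]=\{1,\dots,k\}$; $\varepsilon\in(0,1)$ is the distance parameter and $c>0$. The range $R$ is an arbitrary ordered set of values (not restricted, for instance, to a discrete set $\delta\mathbb{Z}$) for which the differences $f(x)-f(y)$ make sense, i.e. an arbitrary set of real numbers. A function $f:[k]^n\to R$ is $c$-Lipschitz if $|f(x)-f(y)|\le c\|x-y\|_1$ for all $x,y\in[k]^n$. The distance of $f$ to the property, $\varepsilon_f$, is the minimum fraction of points of $[k]^n$ at which $f$ must be changed to become $c$-Lipschitz: $\varepsilon_f=\min_g|\{x:f(x)\ne g(x)\}|/k^n$, the minimum being over all $c$-Lipschitz functions $g:[k]^n\to R$. A one-sided $c$-Lipschitz tester with parameter $\varepsilon$ is a randomized algorithm with query access to $f$ that accepts with probability $1$ if $f$ is $c$-Lipschitz and rejects with probability greater than $2/3$ if $\varepsilon_f>\varepsilon$ (any answer is allowed otherwise). It is non-adaptive if it decides all of its queries in advance, so that the queries are independent of the answers received. *)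

theory Defs
  imports "HOL-Probability.Probability"
begin

type_synonym point = "nat \<Rightarrow> nat"

definition grid :: "nat \<Rightarrow> nat \<Rightarrow> point set" where
  "grid n k = {1..n} \<rightarrow>\<^sub>E {1..k}"

definition l1_dist :: "nat \<Rightarrow> point \<Rightarrow> point \<Rightarrow> real" where
  "l1_dist n x y = (\<Sum>i = 1..n. \<bar>real (x i) - real (y i)\<bar>)"

definition c_lipschitz :: "nat \<Rightarrow> nat \<Rightarrow> real \<Rightarrow> (point \<Rightarrow> real) \<Rightarrow> bool" where
  "c_lipschitz n k c f \<longleftrightarrow>
     (\<forall>x \<in> grid n k. \<forall>y \<in> grid n k. \<bar>f x - f y\<bar> \<le> c * l1_dist n x y)"

text \<open>The competitors \<open>g\<close> must take their values in \<open>R\<close> as well, so the distance depends on \<open>R\<close>.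
  Functions are constrained only on the grid; their values elsewhere play no role.\<close>

definition lipschitz_distance ::
  "nat \<Rightarrow> nat \<Rightarrow> real \<Rightarrow> real set \<Rightarrow> (point \<Rightarrow> real) \<Rightarrow> real" where
  "lipschitz_distance n k c R f =
     Min ((\<lambda>g. real (card {x \<in> grid n k. f x \<noteq> g x}) / real k ^ n) `
          {g \<in> grid n k \<rightarrow> R. c_lipschitz n k c g})"

text \<open>The minimum is over a finite set, which is nonempty as soon as \<open>R\<close> is.\<close>

lemma finite_grid: "finite (grid n k)"
  by (simp add: grid_def finite_PiE)

lemma finite_lipschitz_distance_values:
  "finite ((\<lambda>g. real (card {x \<in> grid n k. f x \<noteq> g x}) / real k ^ n) ` G)"
proof (rule finite_subset)
  show "(\<lambda>g. real (card {x \<in> grid n k. f x \<noteq> g x}) / real k ^ n) ` G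
          \<subseteq> (\<lambda>m. real m / real k ^ n) ` {..card (grid n k)}"
    by (auto intro!: imageI card_mono finite_grid)
qed simp

lemma lipschitz_competitor_exists:
  assumes "r \<in> R" "c > 0"
  shows "(\<lambda>_. r) \<in> {g \<in> grid n k \<rightarrow> R. c_lipschitz n k c g}"
  using assms by (auto simp: c_lipschitz_def l1_dist_def intro!: mult_nonneg_nonneg sum_nonneg)

text \<open>A deterministic, possibly adaptive, query algorithm is a decision tree: it either stops with
  a verdict (\<open>True\<close> for accept) or queries a point and continues depending on the answer.  A
  randomized algorithm is a distribution over such trees: all coins are tossed at the start.\<close>

datatype query_algorithm = Stop bool | Query point "real \<Rightarrow> query_algorithm"

type_synonym randomized_algorithm = "query_algorithm pmf"

primrec accepts :: "query_algorithm \<Rightarrow> (point \<Rightarrow> real) \<Rightarrow> bool" where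
  "accepts (Stop b) f = b"
| "accepts (Query x A) f = accepts (A (f x)) f"

primrec queries :: "query_algorithm \<Rightarrow> (point \<Rightarrow> real) \<Rightarrow> point list" where
  "queries (Stop b) f = []"
| "queries (Query x A) f = x # queries (A (f x)) f"

text \<open>Once the coins are tossed, the list of queries is the same whatever function is queried.\<close>

definition non_adaptive :: "randomized_algorithm \<Rightarrow> bool" where
  "non_adaptive T \<longleftrightarrow> (\<forall>A \<in> set_pmf T. \<forall>f g. queries A f = queries A g)"

definition one_sided_lipschitz_tester ::
  "nat \<Rightarrow> nat \<Rightarrow> real \<Rightarrow> real set \<Rightarrow> real \<Rightarrow> randomized_algorithm \<Rightarrow> bool" where
  "one_sided_lipschitz_tester n k c R \<epsilon> T \<longleftrightarrow>
     (\<forall>f \<in> grid n k \<rightarrow> R.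
        (\<forall>A \<in> set_pmf T. set (queries A f) \<subseteq> grid n k) \<and>
        (c_lipschitz n k c f \<longrightarrow> measure_pmf.prob T {A. accepts A f} = 1) \<and>
        (lipschitz_distance n k c R f > \<epsilon> \<longrightarrow> measure_pmf.prob T {A. \<not> accepts A f} > 2 / 3))"

definition makes_at_most_queries ::
  "nat \<Rightarrow> nat \<Rightarrow> real set \<Rightarrow> randomized_algorithm \<Rightarrow> real \<Rightarrow> bool" where
  "makes_at_most_queries n k R T q \<longleftrightarrow>
     (\<forall>f \<in> grid n k \<rightarrow> R. \<forall>A \<in> set_pmf T. real (length (queries A f)) \<le> q)"

end

theory Submission
  imports Defs
begin

text \<open>
  A function on the grid with values in \<open>R\<close> is \<open>c\<close>-Lipschitz iff \<open>f x\<close> and \<open>f y\<close> are always joined by a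
  chain of at most \<open>\<parallel>x - y\<parallel>\<^sub>1\<close> jumps of length at most \<open>c\<close> inside \<open>R\<close>; when \<open>R\<close> has gaps this says more
  than \<open>\<bar>f x - f y\<bar> \<le> c \<parallel>x - y\<parallel>\<^sub>1\<close>.  Balls of this jump metric are order-convex, hence have the Helly
  property, so partial Lipschitz functions extend within \<open>R\<close> and the distance
  of \<open>f\<close> to the property is governed by the vertex covers of its violating pairs.  Moreover, on finitely many values the jump metric is
  the ceiling of the distance of a real embedding \<open>\<phi>\<close>, so violations of \<open>f\<close> are violations of the
  ordinary 1-Lipschitz condition for the real function \<open>F = \<phi> \<circ> f\<close>.

  Dimension reduction: let \<open>G\<close> minimise \<open>\<Sum> h (F x - G x)\<close> over all \<open>G\<close> that are Lipschitz in the
  directions in \<open>J\<close>, where \<open>h u = sqrt (u\<^sup>2 + \<delta>\<^sup>2)\<close>, and let \<open>Q J = \<Sum> \<bar>h' (F x - G x)\<bar>\<close>.  For small \<open>\<delta>\<close> the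
  points with \<open>\<bar>F x - G x\<bar> \<ge> \<delta>\<close> cover all violations, and there are at most \<open>2 Q {1..n}\<close> of them.  Changing
  \<open>F\<close> on a set \<open>U\<close> changes \<open>Q\<close> by at most \<open>4 card U\<close>, and if \<open>F\<close> is Lipschitz in direction \<open>i\<close> then so is
  its projection, whence \<open>Q (insert i J) = Q J\<close>.  Therefore \<open>Q {1..n}\<close> is at most 8 times the total size of
  vertex covers of the violations along the lines.  Along a line every point is compared with
  \<open>O(log k)\<close> dyadic probes, any two points having a common probe between them; so the points
  that violate with one of their probes form such a cover.
\<close>

section \<open>Chains of short jumps in the range\<close>

text \<open>Exactly \<open>m\<close> jumps are counted, but for \<open>c > 0\<close> standing still
  is a jump, so between points of \<open>R\<close> this means at most \<open>m\<close>
  jumps.\<close>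

fun jump_reach :: "real set \<Rightarrow> real \<Rightarrow> nat \<Rightarrow> real \<Rightarrow> real \<Rightarrow> bool" where
  "jump_reach R c 0 a b \<longleftrightarrow> a = b"
| "jump_reach R c (Suc m) a b \<longleftrightarrow> (\<exists>z\<in>R. \<bar>a - z\<bar> \<le> c \<and> jump_reach R c m z b)"

lemma jump_reach_refl: "c > 0 \<Longrightarrow> a \<in> R \<Longrightarrow> jump_reach R c m a a"
  by (induction m) force+

lemma jump_reach_add:
  assumes "jump_reach R c m a b" "jump_reach R c p b d"
  shows "jump_reach R c (m + p) a d"
  using assms by (induction m arbitrary: a) auto

lemma jump_reach_split:
  assumes "a \<in> R" "jump_reach R c (m + p) a d"
  shows "\<exists>z\<in>R. jump_reach R c m a z \<and> jump_reach R c p z d"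
  using assms
proof (induction m arbitrary: a)
  case (Suc m)
  then obtain z where z: "z \<in> R" "\<bar>a - z\<bar> \<le> c" "jump_reach R c (m + p) z d" by auto
  then obtain z' where "z' \<in> R" "jump_reach R c m z z'" "jump_reach R c p z' d"
    using Suc.IH by blast
  with z show ?case by auto
qed auto

lemma jump_reach_mono:
  assumes "c > 0" "b \<in> R" "jump_reach R c m a b" "m \<le> p"
  shows "jump_reach R c p a b"
  using jump_reach_add[OF assms(3) jump_reach_refl[OF assms(1,2), of "p - m"]] assms(4) by simp

lemma jump_reach_1: "b \<in> R \<Longrightarrow> \<bar>a - b\<bar> \<le> c \<Longrightarrow> jump_reach R c (Suc 0) a b"
  by auto

lemma jump_reach_sym:
  assumes "a \<in> R" "jump_reach R c m a b"
  shows "jump_reach R c m b a"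
  using assms
proof (induction m arbitrary: a)
  case (Suc m)
  then obtain z where z: "z \<in> R" "\<bar>a - z\<bar> \<le> c" "jump_reach R c m z b" by auto
  have "jump_reach R c m b z" by (rule Suc.IH[OF z(1,3)])
  moreover have "jump_reach R c (Suc 0) z a"
    using z Suc.prems by (intro jump_reach_1) auto
  ultimately show ?case
    using jump_reach_add by fastforce
qed auto

lemma jump_reach_bound:
  assumes "jump_reach R c m a b"
  shows "\<bar>a - b\<bar> \<le> c * real m"
  using assms
proof (induction m arbitrary: a)
  case (Suc m)
  then obtain z where z: "\<bar>a - z\<bar> \<le> c" "jump_reach R c m z b" by auto
  have "\<bar>z - b\<bar> \<le> c * real m" by (rule Suc.IH[OF z(2)])
  with z(1) show ?case by (simp add: algebra_simps)
qed auto

text \<open>The first jump that passes over \<open>r\<close> may land on \<open>r\<close> instead,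
  since this only shortens it; the remaining jumps stand still.\<close>

lemma jump_reach_between:
  assumes "c > 0" "r \<in> R" "jump_reach R c m a b" "a \<le> r \<and> r \<le> b \<or> b \<le> r \<and> r \<le> a"
  shows "jump_reach R c m a r"
  using assms(3,4)
proof (induction m arbitrary: a)
  case (Suc m)
  then obtain z where z: "z \<in> R" "\<bar>a - z\<bar> \<le> c" "jump_reach R c m z b" by auto
  show ?case
  proof (cases "z \<le> r \<and> r \<le> b \<or> b \<le> r \<and> r \<le> z")
    case True
    then have "jump_reach R c m z r" using Suc.IH z(3) by blast
    with z show ?thesis by auto
  next
    case False
    then have "\<bar>a - r\<bar> \<le> c" using z(2) Suc.prems(2) by auto
    with jump_reach_refl[OF assms(1,2)] assms(2) show ?thesis by auto
  qed
qed auto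

section \<open>Jump balls: convexity, extension and embedding\<close>

lemma jump_ball_convex:
  assumes "c > 0" "r \<in> R" "jump_reach R c m a b" "jump_reach R c m a b'" "b \<le> r" "r \<le> b'"
  shows "jump_reach R c m a r"
proof (cases "a \<le> r")
  case True
  with assms show ?thesis by (intro jump_reach_between[of c r R m a b']) auto
next
  case False
  with assms show ?thesis by (intro jump_reach_between[of c r R m a b]) auto
qed

text \<open>Choose a common point for every pair of sets. The largest of the minima
  \<open>l i\<close> works: in \<open>B i\<close> it lies between \<open>l i\<close> and the point
  chosen for \<open>B i\<close> and the set attaining the maximum.\<close>

lemma helly_order_convex:
  fixes B :: "'i \<Rightarrow> 'a :: linorder set"
  assumes I: "finite I" "I \<noteq> {}"
    and conv: "\<And>i a b r. i \<in> I \<Longrightarrow> a \<in> B i \<Longrightarrow> b \<in> B i \<Longrightarrow> r \<in> R \<Longrightarrow> a \<le> r \<Longrightarrow> r \<le> b \<Longrightarrow> r \<in> B i"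
    and inter: "\<And>i j. i \<in> I \<Longrightarrow> j \<in> I \<Longrightarrow> B i \<inter> B j \<inter> R \<noteq> {}"
  shows "\<exists>r\<in>R. \<forall>i\<in>I. r \<in> B i"
proof -
  define p where "p i j = (SOME r. r \<in> B i \<inter> B j \<inter> R)" for i j
  have p: "p i j \<in> B i \<inter> B j \<inter> R" if "i \<in> I" "j \<in> I" for i j
    unfolding p_def using inter[OF that] by (rule some_in_eq[THEN iffD2])
  define l where "l i = Min (p i ` I)" for i
  define L where "L = Max (l ` I)"
  have l: "l i \<in> p i ` I" for i
    using I by (simp add: l_def)
  have "L \<in> l ` I" using I by (simp add: L_def)
  then obtain i0 where i0: "i0 \<in> I" "L = l i0" by auto
  have "L \<in> R" using i0 l[of i0] p by force
  moreover have "L \<in> B i" if i: "i \<in> I" for i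
  proof (rule conv[OF i])
    show "l i \<in> B i" using l[of i] p i by force
    show "p i0 i \<in> B i" using p i i0 by auto
    show "l i \<le> L" using I i by (simp add: L_def)
    show "L \<le> p i0 i" using I i by (simp add: i0 l_def)
  qed fact
  ultimately show ?thesis by blast
qed

text \<open>Points are added one at a time. A value for \<open>z\<close> must lie in the jump balls
  of radius \<open>d x z\<close> about all \<open>g x\<close>; two such balls meet because a chain
  of \<open>d x z + d y z\<close> jumps from \<open>g x\<close> to \<open>g y\<close> can be cut
  after \<open>d x z\<close> jumps.\<close>

lemma jump_extension:
  fixes d :: "'a \<Rightarrow> 'a \<Rightarrow> nat" and f :: "'a \<Rightarrow> real"
  assumes c: "c > 0" and R: "R \<noteq> {}"
    and d: "\<And>x. d x x = 0" "\<And>x y. d x y = d y x" "\<And>x y z. d x z \<le> d x y + d y z"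
    and W: "finite W" "f \<in> W \<rightarrow> R"
    and f: "\<And>x y. x \<in> W \<Longrightarrow> y \<in> W \<Longrightarrow> jump_reach R c (d x y) (f x) (f y)"
    and X: "finite X"
  shows "\<exists>g. (\<forall>x\<in>W. g x = f x) \<and> g \<in> W \<union> X \<rightarrow> R \<and>
           (\<forall>x\<in>W \<union> X. \<forall>y\<in>W \<union> X. jump_reach R c (d x y) (g x) (g y))"
  using X
proof (induction X)
  case empty
  show ?case using W f by auto
next
  case (insert z X)
  then obtain g where g: "\<forall>x\<in>W. g x = f x" "g \<in> W \<union> X \<rightarrow> R"
    "\<forall>x\<in>W \<union> X. \<forall>y\<in>W \<union> X. jump_reach R c (d x y) (g x) (g y)" by auto
  show ?case
  proof (cases "z \<in> W \<union> X")
    case True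
    then have "W \<union> insert z X = W \<union> X" by auto
    with g show ?thesis by metis
  next
    case z: False
    have "\<exists>r\<in>R. \<forall>x\<in>W \<union> X. r \<in> {r. jump_reach R c (d x z) (g x) r}"
    proof (cases "W \<union> X = {}")
      case True
      with R show ?thesis by auto
    next
      case False
      show ?thesis
      proof (rule helly_order_convex)
        show "finite (W \<union> X)" using W insert by auto
        show "r \<in> {r. jump_reach R c (d x z) (g x) r}"
          if "a \<in> {r. jump_reach R c (d x z) (g x) r}" "b \<in> {r. jump_reach R c (d x z) (g x) r}"
            "r \<in> R" "a \<le> r" "r \<le> b" for x a b r
          using that jump_ball_convex[OF c] by blast
        fix x y assume xy: "x \<in> W \<union> X" "y \<in> W \<union> X"
        then have "g x \<in> R" "g y \<in> R" using g(2) by auto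
        moreover have "jump_reach R c (d x z + d y z) (g x) (g y)"
          using g(3) xy d(2)[of y z] d(3)[of x y z] \<open>g y \<in> R\<close> jump_reach_mono[OF c] by metis
        ultimately obtain r where "r \<in> R" "jump_reach R c (d x z) (g x) r" "jump_reach R c (d y z) r (g y)"
          using jump_reach_split by metis
        then show "{r. jump_reach R c (d x z) (g x) r} \<inter> {r. jump_reach R c (d y z) (g y) r} \<inter> R \<noteq> {}"
          using jump_reach_sym by blast
      qed (use False in auto)
    qed
    then obtain r where r: "r \<in> R" "\<And>x. x \<in> W \<union> X \<Longrightarrow> jump_reach R c (d x z) (g x) r" by auto
    have r': "jump_reach R c (d z x) r (g x)" if "x \<in> W \<union> X" for x
      using r(2)[OF that] g(2) that jump_reach_sym d(2) by (metis PiE)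
    define g' where "g' = g(z := r)"
    have "\<forall>x\<in>W. g' x = f x" using g(1) z by (auto simp: g'_def)
    moreover have "g' \<in> W \<union> insert z X \<rightarrow> R" using g(2) r(1) by (auto simp: g'_def)
    moreover have "jump_reach R c (d x y) (g' x) (g' y)"
      if "x \<in> W \<union> insert z X" "y \<in> W \<union> insert z X" for x y
      using that g(3) r(2)[of x] r'[of y] d(1) by (auto simp: g'_def)
    ultimately show ?thesis by blast
  qed
qed

text \<open>The embedding is built from left to right.  Equality is excluded on both sides because the
  induction step needs strict inequalities to find room for the new point.\<close>

lemma jump_embedding:
  assumes c: "c > 0" and X: "finite X" "X \<subseteq> R"
  shows "\<exists>\<phi>. \<forall>a\<in>X. \<forall>b\<in>X. \<forall>m\<le>M. a < b \<longrightarrow>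
           (if jump_reach R c m a b then \<phi> b < \<phi> a + real m else \<phi> b > \<phi> a + real m)"
  using X
proof (induction X rule: finite_linorder_max_induct)
  case empty
  show ?case by simp
next
  case (insert v X)
  then have "X \<subseteq> R" by auto
  from insert.IH[OF this] obtain \<phi> where \<phi>: "\<And>a b m. a \<in> X \<Longrightarrow> b \<in> X \<Longrightarrow> m \<le> M \<Longrightarrow> a < b \<Longrightarrow>
     (if jump_reach R c m a b then \<phi> b < \<phi> a + real m else \<phi> b > \<phi> a + real m)" by blast
  \<comment> \<open>A value \<open>t\<close> for the new point \<open>v\<close> must lie below
    \<open>h e\<close> for \<open>e\<close> in \<open>Up\<close> and above \<open>h e\<close> for
    \<open>e\<close> in \<open>Lo\<close>. It exists once every lower bound is below every upper
    bound, which is what \<open>less\<close> shows.\<close>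
  define Up where "Up = {(a, m). a \<in> X \<and> m \<le> M \<and> jump_reach R c m a v}"
  define Lo where "Lo = {(a, m). a \<in> X \<and> m \<le> M \<and> \<not> jump_reach R c m a v}"
  define h where "h = (\<lambda>(a, m). \<phi> a + real m)"
  have "Up \<subseteq> X \<times> {..M}" "Lo \<subseteq> X \<times> {..M}" by (auto simp: Up_def Lo_def)
  then have fin: "finite Up" "finite Lo"
    using insert.hyps(1) by (auto intro: finite_subset)
  have less: "h (j, p) < h (l, m)" if jp: "(j, p) \<in> Lo" and lm: "(l, m) \<in> Up" for j p l m
  proof -
    have in_X: "j \<in> X" "l \<in> X" "j \<in> R" "l \<in> R" "v \<in> R" "j < v" "l < v" and le: "p \<le> M" "m \<le> M"
      and reach: "\<not> jump_reach R c p j v" "jump_reach R c m l v"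
      using jp lm insert.hyps insert.prems by (auto simp: Up_def Lo_def)
    consider "j = l" | "j < l" | "l < j" by force
    then show ?thesis
    proof cases
      case 1
      then have "p < m"
        using reach jump_reach_mono[OF c, of v] in_X by (meson not_le)
      with 1 show ?thesis by (simp add: h_def)
    next
      case 2
      show ?thesis
      proof (cases "m \<le> p")
        case True
        \<comment> \<open>A chain of \<open>p - m\<close> jumps from \<open>j\<close> to
          \<open>l\<close> would extend to a forbidden chain of \<open>p\<close> jumps from
          \<open>j\<close> to \<open>v\<close>.\<close>
        have "\<not> jump_reach R c (p - m) j l"
          using jump_reach_add[of R c "p - m" j l m v] reach True by auto
        then have "\<phi> l > \<phi> j + real (p - m)"
          using \<phi>[of j l "p - m"] in_X le 2 by auto
        with True show ?thesis by (simp add: h_def of_nat_diff)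
      next
        case False
        have "\<phi> l > \<phi> j" using \<phi>[of j l 0] in_X 2 by auto
        with False show ?thesis by (simp add: h_def)
      qed
    next
      \<comment> \<open>Here \<open>l < j < v\<close>. A chain from \<open>l\<close> to
        \<open>v\<close> is cut after \<open>m - p\<close> jumps. The cut point lies right of
        \<open>j\<close>, since otherwise \<open>v\<close> would reach back to \<open>j\<close> in
        \<open>p\<close> jumps; hence \<open>l\<close> reaches \<open>j\<close> in
        \<open>m - p\<close> jumps.\<close>
      case 3
      have "jump_reach R c m v l" using reach in_X jump_reach_sym by blast
      then have "jump_reach R c m v j"
        using 3 in_X c by (intro jump_reach_between[of c j R m v l]) auto
      then have "jump_reach R c m j v" using in_X jump_reach_sym by blast
      then have "p < m"
        using reach jump_reach_mono[OF c, of v] in_X by (meson not_le)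
      then have "jump_reach R c ((m - p) + p) l v" using reach by simp
      then obtain z where z: "z \<in> R" "jump_reach R c (m - p) l z" "jump_reach R c p z v"
        using jump_reach_split in_X by blast
      have "z > j"
      proof (rule ccontr)
        assume "\<not> z > j"
        have "jump_reach R c p v z" using z jump_reach_sym by blast
        then have "jump_reach R c p v j"
          using \<open>\<not> z > j\<close> in_X c by (intro jump_reach_between[of c j R p v z]) auto
        then show False using reach in_X jump_reach_sym by blast
      qed
      then have "jump_reach R c (m - p) l j"
        using 3 z in_X c by (intro jump_reach_between[of c j R "m - p" l z]) auto
      then have "\<phi> j < \<phi> l + real (m - p)"
        using \<phi>[of l j "m - p"] in_X le 3 by auto
      with \<open>p < m\<close> show ?thesis by (simp add: h_def of_nat_diff)
    qed
  qed
  have "\<exists>t. (\<forall>e\<in>Lo. h e < t) \<and> (\<forall>e\<in>Up. t < h e)"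
  proof (cases "Lo = {} \<or> Up = {}")
    case True
    \<comment> \<open>The inserted \<open>0\<close> only makes \<open>Max\<close> and
      \<open>Min\<close> defined on an empty set. As one side is empty, \<open>t\<close> can be
      placed one unit beyond the other.\<close>
    have "h e \<le> Max (insert 0 (h ` Lo))" if "e \<in> Lo" for e
      using fin that by (intro Max_ge) auto
    then have "h e < Max (insert 0 (h ` Lo)) + 1" if "e \<in> Lo" for e
      using that by fastforce
    moreover have "Min (insert 0 (h ` Up)) \<le> h e" if "e \<in> Up" for e
      using fin that by (intro Min_le) auto
    then have "Min (insert 0 (h ` Up)) - 1 < h e" if "e \<in> Up" for e
      using that by fastforce
    ultimately show ?thesis using True by blast
  next
    case False
    then have "Max (h ` Lo) \<in> h ` Lo" "Min (h ` Up) \<in> h ` Up"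
      using fin by (auto intro!: Max_in Min_in)
    then have "Max (h ` Lo) < Min (h ` Up)" using less by force
    then obtain t where t: "Max (h ` Lo) < t" "t < Min (h ` Up)" using dense by blast
    have "h e \<le> Max (h ` Lo)" if "e \<in> Lo" for e
      using fin that by (intro Max_ge) auto
    moreover have "Min (h ` Up) \<le> h e" if "e \<in> Up" for e
      using fin that by (intro Min_le) auto
    ultimately have "\<forall>e\<in>Lo. h e < t" "\<forall>e\<in>Up. t < h e"
      using t by fastforce+
    then show ?thesis by blast
  qed
  then obtain t where t: "\<And>e. e \<in> Lo \<Longrightarrow> h e < t" "\<And>e. e \<in> Up \<Longrightarrow> t < h e" by blast
  have v: "v \<notin> X" using insert.hyps by auto
  show ?case
  proof (intro exI ballI allI impI)
    fix a b m assume ab: "a \<in> insert v X" "b \<in> insert v X" and m: "m \<le> M" and "a < b"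
    show "if jump_reach R c m a b then (\<phi>(v := t)) b < (\<phi>(v := t)) a + real m
          else (\<phi>(v := t)) b > (\<phi>(v := t)) a + real m"
    proof (cases "b = v")
      case True
      then have "a \<in> X" "a \<noteq> v" using ab \<open>a < b\<close> by auto
      then show ?thesis
        using t(1)[of "(a, m)"] t(2)[of "(a, m)"] m True by (auto simp: Up_def Lo_def h_def)
    next
      case False
      then have "b \<in> X" "b < v" using ab insert.hyps by auto
      then have "a \<in> X" "a \<noteq> v" using ab \<open>a < b\<close> by auto
      then show ?thesis using \<phi>[of a b m] False \<open>b \<in> X\<close> m \<open>a < b\<close> by simp
    qed
  qed
qed

text \<open>The case \<open>m = 0\<close> makes \<open>\<phi>\<close> strictly increasing on
  \<open>X\<close>, so the one-sided bounds become bounds on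
  \<open>\<bar>\<phi> a - \<phi> b\<bar>\<close>. The cap \<open>M\<close> keeps the number of
  constraints finite.\<close>

corollary jump_embedding_iff:
  assumes c: "c > 0" and X: "finite X" "X \<subseteq> R"
  shows "\<exists>\<phi> :: real \<Rightarrow> real. \<forall>a\<in>X. \<forall>b\<in>X. \<forall>m\<le>M. jump_reach R c m a b \<longleftrightarrow> \<bar>\<phi> a - \<phi> b\<bar> \<le> real m"
proof -
  obtain \<phi> where \<phi>: "\<forall>a\<in>X. \<forall>b\<in>X. \<forall>m\<le>M. a < b \<longrightarrow>
     (if jump_reach R c m a b then \<phi> b < \<phi> a + real m else \<phi> b > \<phi> a + real m)"
    using jump_embedding[OF assms] by blast
  have less: "jump_reach R c m a b \<longleftrightarrow> \<bar>\<phi> a - \<phi> b\<bar> \<le> real m"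
    if ab: "a \<in> X" "b \<in> X" "m \<le> M" "a < b" for a b m
  proof -
    have "if jump_reach R c 0 a b then \<phi> b < \<phi> a + real 0 else \<phi> b > \<phi> a + real 0"
      using \<phi> ab by blast
    then have "\<phi> b > \<phi> a" using ab by simp
    moreover have "if jump_reach R c m a b then \<phi> b < \<phi> a + real m else \<phi> b > \<phi> a + real m"
      using \<phi> ab by blast
    ultimately show ?thesis by (auto split: if_splits)
  qed
  have "jump_reach R c m a b \<longleftrightarrow> \<bar>\<phi> a - \<phi> b\<bar> \<le> real m" if ab: "a \<in> X" "b \<in> X" "m \<le> M" for a b m
  proof -
    have R: "a \<in> R" "b \<in> R" using ab X by auto
    consider "a < b" | "b < a" | "a = b" by force
    then show ?thesis
    proof cases
      case 1
      with less ab show ?thesis by blast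
    next
      case 2
      then show ?thesis
        using less[OF ab(2,1,3)] jump_reach_sym[of _ R c m] R abs_minus_commute by metis
    next
      case 3
      with jump_reach_refl[OF c] R show ?thesis by auto
    qed
  qed
  then show ?thesis by blast
qed

section \<open>Smoothed projection onto difference constraints\<close>

definition smooth_abs :: "real \<Rightarrow> real \<Rightarrow> real" where
  "smooth_abs \<delta> u = sqrt (u\<^sup>2 + \<delta>\<^sup>2)"

text \<open>The derivative of \<open>smooth_abs\<close>. For \<open>\<delta> > 0\<close> it is a
  strictly increasing substitute for the sign function: strictness drives the comparison arguments,
  and the bound 1 limits the influence of each point.\<close>

definition smooth_sgn :: "real \<Rightarrow> real \<Rightarrow> real" where
  "smooth_sgn \<delta> u = u / sqrt (u\<^sup>2 + \<delta>\<^sup>2)"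

lemma smooth_abs_has_derivative:
  assumes "\<delta> > 0"
  shows "(smooth_abs \<delta> has_real_derivative smooth_sgn \<delta> u) (at u)"
proof -
  have pos: "u\<^sup>2 + \<delta>\<^sup>2 > 0"
    using assms by (simp add: add_nonneg_pos)
  show ?thesis
    unfolding smooth_abs_def smooth_sgn_def using pos
    by (auto intro!: derivative_eq_intros simp: field_simps)
qed

lemma smooth_abs_mono: "\<bar>u\<bar> \<le> \<bar>v\<bar> \<Longrightarrow> smooth_abs \<delta> u \<le> smooth_abs \<delta> v"
  by (simp add: smooth_abs_def abs_le_square_iff)

text \<open>The function is the sine of \<open>arctan (u / \<delta>)\<close>, and the sine is
  increasing on the range of \<open>arctan\<close>.\<close>

lemma smooth_sgn_less:
  assumes "\<delta> > 0" "u < v"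
  shows "smooth_sgn \<delta> u < smooth_sgn \<delta> v"
proof -
  have *: "smooth_sgn \<delta> t = sin (arctan (t / \<delta>))" for t
  proof -
    have "sqrt (t\<^sup>2 + \<delta>\<^sup>2) = \<delta> * sqrt (1 + (t / \<delta>)\<^sup>2)"
    proof -
      have "t\<^sup>2 + \<delta>\<^sup>2 = \<delta>\<^sup>2 * (1 + (t / \<delta>)\<^sup>2)"
        using assms by (simp add: field_simps)
      then show ?thesis
        using assms by (simp add: real_sqrt_mult)
    qed
    then show ?thesis
      using assms by (simp add: smooth_sgn_def sin_arctan)
  qed
  have "arctan (u / \<delta>) < arctan (v / \<delta>)"
    using assms by (simp add: arctan_less_iff divide_strict_right_mono)
  then show ?thesis
    unfolding * by (intro sin_monotone_2pi) (use arctan_bounded in \<open>auto intro: less_imp_le\<close>)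
qed

lemma smooth_sgn_le: "\<delta> > 0 \<Longrightarrow> u \<le> v \<Longrightarrow> smooth_sgn \<delta> u \<le> smooth_sgn \<delta> v"
  using smooth_sgn_less by (cases "u = v") (auto intro: less_imp_le)

lemma abs_smooth_sgn_le_1: "\<bar>smooth_sgn \<delta> u\<bar> \<le> 1"
proof -
  have "\<bar>u\<bar> \<le> sqrt (u\<^sup>2 + \<delta>\<^sup>2)"
    using real_sqrt_ge_abs1 by blast
  moreover have "sqrt (u\<^sup>2 + \<delta>\<^sup>2) \<ge> 0" by simp
  ultimately show ?thesis
    unfolding smooth_sgn_def abs_divide by (intro divide_le_eq_1[THEN iffD2]) linarith
qed

text \<open>The root in the denominator is at most \<open>2 * \<bar>u\<bar>\<close>. This lets a sum
  of \<open>\<bar>smooth_sgn\<bar>\<close> bound the number of points far from the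
  projection.\<close>

lemma abs_smooth_sgn_ge_half:
  assumes "\<delta> > 0" "\<bar>u\<bar> \<ge> \<delta>"
  shows "\<bar>smooth_sgn \<delta> u\<bar> \<ge> 1 / 2"
proof -
  have "\<delta>\<^sup>2 \<le> u\<^sup>2"
    using assms by (metis abs_le_square_iff abs_of_pos)
  moreover have "(2 * \<bar>u\<bar>)\<^sup>2 = 4 * u\<^sup>2"
    by (simp add: power_mult_distrib)
  ultimately have "u\<^sup>2 + \<delta>\<^sup>2 \<le> (2 * \<bar>u\<bar>)\<^sup>2"
    using zero_le_power2[of u] by linarith
  then have "sqrt (u\<^sup>2 + \<delta>\<^sup>2) \<le> sqrt ((2 * \<bar>u\<bar>)\<^sup>2)"
    by (rule real_sqrt_le_mono)
  then have "sqrt (u\<^sup>2 + \<delta>\<^sup>2) \<le> 2 * \<bar>u\<bar>"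
    unfolding real_sqrt_abs by linarith
  moreover have "sqrt (u\<^sup>2 + \<delta>\<^sup>2) > 0"
    using assms by (simp add: add_nonneg_pos)
  ultimately show ?thesis
    by (simp add: smooth_sgn_def abs_divide field_simps)
qed

section \<open>Cost minimisers under difference constraints\<close>

definition feasible :: "('a \<times> 'a) set \<Rightarrow> ('a \<Rightarrow> 'a \<Rightarrow> real) \<Rightarrow> ('a \<Rightarrow> real) \<Rightarrow> bool" where
  "feasible E w G \<longleftrightarrow> (\<forall>(x, y) \<in> E. G x \<le> G y + w x y)"

definition proj_cost :: "'a set \<Rightarrow> real \<Rightarrow> ('a \<Rightarrow> real) \<Rightarrow> ('a \<Rightarrow> real) \<Rightarrow> real" where
  "proj_cost V \<delta> F G = (\<Sum>x\<in>V. smooth_abs \<delta> (F x - G x))"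

definition is_projection ::
  "'a set \<Rightarrow> real \<Rightarrow> ('a \<times> 'a) set \<Rightarrow> ('a \<Rightarrow> 'a \<Rightarrow> real) \<Rightarrow> ('a \<Rightarrow> real) \<Rightarrow> ('a \<Rightarrow> real) \<Rightarrow> bool"
  where "is_projection V \<delta> E w F G \<longleftrightarrow>
    feasible E w G \<and> (\<forall>H. feasible E w H \<longrightarrow> proj_cost V \<delta> F G \<le> proj_cost V \<delta> F H)"

lemma feasibleD: "feasible E w G \<Longrightarrow> (x, y) \<in> E \<Longrightarrow> G x \<le> G y + w x y"
  by (auto simp: feasible_def)

text \<open>Truncating a feasible function to \<open>[-B, B]\<close> keeps it feasible because
  \<open>w\<close> is nonnegative, and does not raise the cost because \<open>B\<close> bounds
  \<open>F\<close> on \<open>V\<close>. So it suffices to minimise over a compact set.\<close>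

lemma projection_exists:
  fixes V :: "'a set"
  assumes V: "finite V" and E: "E \<subseteq> V \<times> V" and w: "\<And>x y. w x y \<ge> 0"
  shows "\<exists>G. is_projection V \<delta> E w F G"
proof -
  define B where "B = (\<Sum>x\<in>V. \<bar>F x\<bar>)"
  have B: "\<bar>F x\<bar> \<le> B" if "x \<in> V" for x
    unfolding B_def using that V by (meson abs_ge_zero member_le_sum)
  have B0: "B \<ge> 0" by (simp add: B_def sum_nonneg)
  \<comment> \<open>Coordinates outside \<open>V\<close> are pinned to \<open>0\<close>, so that
    \<open>K\<close> is a product of compact sets.\<close>
  define K :: "('a \<Rightarrow> real) set" where "K = (\<Pi>\<^sub>E x\<in>UNIV. if x \<in> V then {-B..B} else {0})"
  have "compact K"
    using compactin_PiE[of "\<lambda>_. euclidean" UNIV "\<lambda>x. if x \<in> V then {-B..B} else {0::real}"]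
    unfolding K_def by (auto simp: euclidean_product_topology)
  moreover have "closed {G. feasible E w G}"
  proof -
    have "{G. feasible E w G} = (\<Inter>(x, y)\<in>E. {G. G x \<le> G y + w x y})"
      by (auto simp: feasible_def)
    also have "closed \<dots>"
      by (auto intro!: closed_INT closed_Collect_le continuous_intros)
    finally show ?thesis .
  qed
  ultimately have comp: "compact (K \<inter> {G. feasible E w G})"
    by (rule compact_Int_closed)
  have "(\<lambda>_. 0) \<in> K \<inter> {G. feasible E w G}"
    using B0 w by (auto simp: K_def feasible_def)
  moreover have "continuous_on (K \<inter> {G. feasible E w G}) (proj_cost V \<delta> F)"
    unfolding proj_cost_def smooth_abs_def
    by (intro continuous_intros continuous_on_subset[OF continuous_on_product_coordinates]) auto
  ultimately obtain G where G: "G \<in> K" "feasible E w G"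
    and min: "\<And>H. H \<in> K \<Longrightarrow> feasible E w H \<Longrightarrow> proj_cost V \<delta> F G \<le> proj_cost V \<delta> F H"
    using continuous_attains_inf[OF comp] by (metis (no_types, lifting) IntD1 IntD2 IntI empty_iff mem_Collect_eq)
  have "proj_cost V \<delta> F G \<le> proj_cost V \<delta> F H" if H: "feasible E w H" for H
  proof -
    define H' where "H' x = (if x \<in> V then max (-B) (min B (H x)) else 0)" for x
    have "H' \<in> K"
      using B0 by (auto simp: K_def H'_def)
    moreover have "feasible E w H'"
      unfolding feasible_def
    proof safe
      fix x y assume xy: "(x, y) \<in> E"
      then have "x \<in> V" "y \<in> V" using E by auto
      then show "H' x \<le> H' y + w x y"
        using feasibleD[OF H xy] w[of x y] by (auto simp: H'_def)
    qed
    ultimately have "proj_cost V \<delta> F G \<le> proj_cost V \<delta> F H'"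
      by (rule min)
    also have "\<dots> \<le> proj_cost V \<delta> F H"
      unfolding proj_cost_def
    proof (intro sum_mono smooth_abs_mono)
      fix x assume "x \<in> V"
      then show "\<bar>F x - H' x\<bar> \<le> \<bar>F x - H x\<bar>"
        using B[of x] by (auto simp: H'_def)
    qed
    finally show ?thesis .
  qed
  then show ?thesis
    using G unfolding is_projection_def by blast
qed

text \<open>First-order optimality. A small move of \<open>G\<close> along \<open>p\<close>
  preserves slack constraints by continuity and tight ones because \<open>p x \<le> p y\<close>. The
  cost has minus the displayed sum as its derivative, so a positive sum would make it fall.\<close>

lemma projection_variation:
  fixes V :: "'a set" and p :: "'a \<Rightarrow> real"
  assumes \<delta>: "\<delta> > 0" and V: "finite V" and E: "E \<subseteq> V \<times> V"
    and G: "is_projection V \<delta> E w F G"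
    and tight: "\<And>x y. (x, y) \<in> E \<Longrightarrow> G x = G y + w x y \<Longrightarrow> p x \<le> p y"
  shows "(\<Sum>x\<in>V. p x * smooth_sgn \<delta> (F x - G x)) \<le> 0"
proof (rule ccontr)
  assume neg: "\<not> ?thesis"
  have "finite E"
    using V E by (meson finite_SigmaI finite_subset)
  define g where "g t = proj_cost V \<delta> F (\<lambda>x. G x + t * p x)" for t
  have "(g has_real_derivative (\<Sum>x\<in>V. smooth_sgn \<delta> (F x - (G x + 0 * p x)) * - p x)) (at 0)"
    unfolding g_def proj_cost_def
  proof (rule DERIV_sum)
    fix x assume "x \<in> V"
    have "((\<lambda>t. F x - (G x + t * p x)) has_real_derivative - p x) (at 0)"
      by (auto intro!: derivative_eq_intros)
    from DERIV_chain2[OF smooth_abs_has_derivative[OF \<delta>] this]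
    show "((\<lambda>t. smooth_abs \<delta> (F x - (G x + t * p x))) has_real_derivative
             smooth_sgn \<delta> (F x - (G x + 0 * p x)) * - p x) (at 0)" .
  qed
  moreover have "(\<Sum>x\<in>V. smooth_sgn \<delta> (F x - (G x + 0 * p x)) * - p x) < 0"
    using neg by (simp add: sum_negf mult.commute)
  ultimately have "\<exists>d>0. \<forall>h>0. h < d \<longrightarrow> g (0 + h) < g 0"
    by (rule DERIV_neg_dec_right)
  then obtain d where d: "d > 0" "\<And>h. h > 0 \<Longrightarrow> h < d \<Longrightarrow> g h < g 0"
    by auto
  have "eventually (\<lambda>t. G x + t * p x \<le> G y + t * p y + w x y) (at_right 0)" if "(x, y) \<in> E" for x y
  proof (cases "G x = G y + w x y")
    case True
    show ?thesis
      using eventually_at_right_less[of "0::real"]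
      by eventually_elim (use tight[OF that True] True in \<open>auto intro: mult_left_mono\<close>)
  next
    case False
    then have less: "G x < G y + w x y"
      using G that by (auto simp: is_projection_def dest: feasibleD)
    have "((\<lambda>t. G y + t * p y + w x y - (G x + t * p x)) \<longlongrightarrow> G y + 0 * p y + w x y - (G x + 0 * p x)) (at_right 0)"
      by (intro tendsto_intros)
    then have "eventually (\<lambda>t. G y + t * p y + w x y - (G x + t * p x) > 0) (at_right 0)"
      by (rule order_tendstoD) (use less in simp)
    then show ?thesis
      by eventually_elim simp
  qed
  then have "eventually (\<lambda>t. \<forall>e\<in>E. G (fst e) + t * p (fst e) \<le> G (snd e) + t * p (snd e) + w (fst e) (snd e))
    (at_right 0)"
    using \<open>finite E\<close> by (intro eventually_ball_finite) auto
  moreover have "eventually (\<lambda>t. t \<in> {0<..<d}) (at_right 0)"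
    using d(1) by (rule eventually_at_right_real)
  ultimately have "eventually (\<lambda>t. False) (at_right (0::real))"
  proof eventually_elim
    case (elim t)
    then have "feasible E w (\<lambda>x. G x + t * p x)"
      by (auto simp: feasible_def)
    then have "g 0 \<le> g t"
      using G by (simp add: is_projection_def g_def)
    with d(2)[of t] elim show False by auto
  qed
  then show False by simp
qed

text \<open>Variation along the indicator of \<open>D\<close>: no tight constraint bounds a point of
  \<open>D\<close> by a point outside, so \<open>D\<close> can be raised as a whole.\<close>

lemma projection_raise:
  fixes V :: "'a set"
  assumes "\<delta> > 0" "finite V" "E \<subseteq> V \<times> V" "is_projection V \<delta> E w F G" "D \<subseteq> V"
    and "\<And>x y. (x, y) \<in> E \<Longrightarrow> x \<in> D \<Longrightarrow> y \<notin> D \<Longrightarrow> G x < G y + w x y"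
  shows "(\<Sum>x\<in>D. smooth_sgn \<delta> (F x - G x)) \<le> 0"
proof -
  have "(\<Sum>x\<in>V. indicator D x * smooth_sgn \<delta> (F x - G x)) \<le> 0"
    by (rule projection_variation[OF assms(1-4)])
       (use assms(6) in \<open>force simp: indicator_def\<close>)
  moreover have "(\<Sum>x\<in>V. indicator D x * smooth_sgn \<delta> (F x - G x)) = (\<Sum>x\<in>D. smooth_sgn \<delta> (F x - G x))"
    using assms(2,5) by (intro sum.mono_neutral_cong_right) (auto simp: indicator_def)
  ultimately show ?thesis by simp
qed

text \<open>Dual to \<open>projection_raise\<close>: the direction is minus the indicator of
  \<open>D\<close>.\<close>

lemma projection_lower:
  fixes V :: "'a set"
  assumes "\<delta> > 0" "finite V" "E \<subseteq> V \<times> V" "is_projection V \<delta> E w F G" "D \<subseteq> V"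
    and "\<And>x y. (x, y) \<in> E \<Longrightarrow> x \<notin> D \<Longrightarrow> y \<in> D \<Longrightarrow> G x < G y + w x y"
  shows "(\<Sum>x\<in>D. smooth_sgn \<delta> (F x - G x)) \<ge> 0"
proof -
  have "(\<Sum>x\<in>V. - indicator D x * smooth_sgn \<delta> (F x - G x)) \<le> 0"
    by (rule projection_variation[OF assms(1-4)])
       (use assms(6) in \<open>force simp: indicator_def\<close>)
  then have "(\<Sum>x\<in>V. indicator D x * smooth_sgn \<delta> (F x - G x)) \<ge> 0"
    by (simp add: sum_negf)
  moreover have "(\<Sum>x\<in>V. indicator D x * smooth_sgn \<delta> (F x - G x)) = (\<Sum>x\<in>D. smooth_sgn \<delta> (F x - G x))"
    using assms(2,5) by (intro sum.mono_neutral_cong_right) (auto simp: indicator_def)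
  ultimately show ?thesis by simp
qed

text \<open>The set \<open>{x. G x < G' x}\<close> can be raised in \<open>G\<close> and lowered in \<open>G'\<close>.  Where \<open>F\<close> and \<open>F'\<close>
  agree, the derivative of the cost is larger for \<open>G\<close> than for \<open>G'\<close> on this set, so the
  total discrepancy is paid for by the points of \<open>U\<close>.\<close>

lemma projection_stability_half:
  fixes V :: "'a set"
  assumes \<delta>: "\<delta> > 0" and V: "finite V" and E: "E \<subseteq> V \<times> V"
    and G: "is_projection V \<delta> E w F G" and G': "is_projection V \<delta> E w F' G'"
    and U: "U \<subseteq> V" "\<And>x. x \<in> V \<Longrightarrow> x \<notin> U \<Longrightarrow> F x = F' x"
  defines "D \<equiv> {x \<in> V. G x < G' x}"
  shows "(\<Sum>x\<in>D. \<bar>smooth_sgn \<delta> (F x - G x) - smooth_sgn \<delta> (F' x - G' x)\<bar>) \<le> 4 * real (card (U \<inter> D))"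
proof -
  define s where "s x = smooth_sgn \<delta> (F x - G x)" for x
  define s' where "s' x = smooth_sgn \<delta> (F' x - G' x)" for x
  have fe: "feasible E w G" "feasible E w G'"
    using G G' by (auto simp: is_projection_def)
  have fin: "finite D" and DV: "D \<subseteq> V" using V by (auto simp: D_def)
  have "(\<Sum>x\<in>D. s x) \<le> 0"
    unfolding s_def
  proof (rule projection_raise[OF \<delta> V E G DV])
    fix x y assume "(x, y) \<in> E" "x \<in> D" "y \<notin> D"
    \<comment> \<open>\<open>G x < G' x \<le> G' y + w x y \<le> G y + w x y\<close>, the last
      because \<open>y\<close> lies in \<open>V\<close> but not in \<open>D\<close>.\<close>
    then show "G x < G y + w x y"
      using feasibleD[OF fe(2), of x y] E by (auto simp: D_def)
  qed
  moreover have "(\<Sum>x\<in>D. s' x) \<ge> 0"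
    unfolding s'_def
  proof (rule projection_lower[OF \<delta> V E G' DV])
    fix x y assume "(x, y) \<in> E" "x \<notin> D" "y \<in> D"
    then show "G' x < G' y + w x y"
      using feasibleD[OF fe(1), of x y] E by (auto simp: D_def)
  qed
  ultimately have 1: "(\<Sum>x\<in>D. s x - s' x) \<le> 0"
    by (simp add: sum_subtractf)
  \<comment> \<open>Off \<open>U\<close> the difference is nonnegative. On \<open>U\<close> it lies
    in [-2, 2], where \<open>\<bar>t\<bar> \<le> t + 4\<close>.\<close>
  have "(\<Sum>x\<in>D. \<bar>s x - s' x\<bar>) \<le> (\<Sum>x\<in>D. (s x - s' x) + (if x \<in> U then 4 else 0))"
  proof (rule sum_mono)
    fix x assume x: "x \<in> D"
    show "\<bar>s x - s' x\<bar> \<le> (s x - s' x) + (if x \<in> U then 4 else 0)"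
    proof (cases "x \<in> U")
      case True
      have "\<bar>s x\<bar> \<le> 1" "\<bar>s' x\<bar> \<le> 1"
        by (simp_all add: s_def s'_def abs_smooth_sgn_le_1)
      with True show ?thesis by (auto simp: abs_if split: if_splits)
    next
      case False
      then have "s x \<ge> s' x"
        using x U(2)[of x] smooth_sgn_le[OF \<delta>] by (auto simp: s_def s'_def D_def)
      with False show ?thesis by simp
    qed
  qed
  also have "\<dots> = (\<Sum>x\<in>D. s x - s' x) + 4 * real (card (U \<inter> D))"
    using fin by (simp add: sum.distrib sum.If_cases Int_commute)
  finally show ?thesis
    using 1 by (simp add: s_def s'_def)
qed

text \<open>\<open>V\<close> splits by the sign of \<open>G' x - G x\<close>. The two strict parts
  follow from \<open>projection_stability_half\<close>, used both ways round; where \<open>G\<close>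
  and \<open>G'\<close> agree, only points of \<open>U\<close> contribute, at most 2 each.\<close>

lemma projection_stability:
  fixes V :: "'a set"
  assumes \<delta>: "\<delta> > 0" and V: "finite V" and E: "E \<subseteq> V \<times> V"
    and G: "is_projection V \<delta> E w F G" and G': "is_projection V \<delta> E w F' G'"
    and U: "U \<subseteq> V" "\<And>x. x \<in> V \<Longrightarrow> x \<notin> U \<Longrightarrow> F x = F' x"
  shows "(\<Sum>x\<in>V. \<bar>smooth_sgn \<delta> (F x - G x) - smooth_sgn \<delta> (F' x - G' x)\<bar>) \<le> 4 * real (card U)"
proof -
  define r where "r x = \<bar>smooth_sgn \<delta> (F x - G x) - smooth_sgn \<delta> (F' x - G' x)\<bar>" for x
  define D1 where "D1 = {x \<in> V. G x < G' x}"
  define D2 where "D2 = {x \<in> V. G' x < G x}"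
  define D0 where "D0 = {x \<in> V. G x = G' x}"
  have fin: "finite D0" "finite D1" "finite D2" "finite U"
    using V U(1) finite_subset by (auto simp: D0_def D1_def D2_def)
  have V_eq: "V = (D1 \<union> D2) \<union> D0" and disj: "D1 \<inter> D2 = {}" "(D1 \<union> D2) \<inter> D0 = {}"
    by (auto simp: D0_def D1_def D2_def)
  have "(\<Sum>x\<in>D1. r x) \<le> 4 * real (card (U \<inter> D1))"
    unfolding r_def D1_def by (rule projection_stability_half[OF \<delta> V E G G' U])
  moreover have "(\<Sum>x\<in>D2. r x) \<le> 4 * real (card (U \<inter> D2))"
    unfolding r_def D2_def
    by (subst abs_minus_commute) (rule projection_stability_half[OF \<delta> V E G' G U(1)], simp add: U(2))
  moreover have "(\<Sum>x\<in>D0. r x) \<le> 4 * real (card (U \<inter> D0))"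
  proof -
    have "(\<Sum>x\<in>D0. r x) \<le> (\<Sum>x\<in>D0. if x \<in> U then 4 else 0)"
    proof (rule sum_mono)
      fix x assume x: "x \<in> D0"
      have "\<bar>smooth_sgn \<delta> (F x - G x)\<bar> \<le> 1" "\<bar>smooth_sgn \<delta> (F' x - G' x)\<bar> \<le> 1"
        by (simp_all add: abs_smooth_sgn_le_1)
      then show "r x \<le> (if x \<in> U then 4 else 0)"
        using x U(2)[of x] by (auto simp: r_def D0_def)
    qed
    also have "\<dots> = 4 * real (card (U \<inter> D0))"
      using fin by (simp add: sum.If_cases Int_commute)
    finally show ?thesis .
  qed
  moreover have "(\<Sum>x\<in>V. r x) = (\<Sum>x\<in>D1. r x) + (\<Sum>x\<in>D2. r x) + (\<Sum>x\<in>D0. r x)"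
    unfolding V_eq using fin disj by (simp add: sum.union_disjoint)
  moreover have "card U = card (U \<inter> D1) + card (U \<inter> D2) + card (U \<inter> D0)"
  proof -
    have "U = (U \<inter> D1 \<union> U \<inter> D2) \<union> U \<inter> D0" using U(1) V_eq by auto
    also have "card \<dots> = card (U \<inter> D1 \<union> U \<inter> D2) + card (U \<inter> D0)"
      using fin disj by (intro card_Un_disjoint) auto
    also have "card (U \<inter> D1 \<union> U \<inter> D2) = card (U \<inter> D1) + card (U \<inter> D2)"
      using fin disj by (intro card_Un_disjoint) auto
    finally show ?thesis .
  qed
  ultimately show ?thesis
    by (simp add: r_def)
qed

text \<open>Comparison principle: where \<open>G (\<sigma> x) > G x + a\<close>, one could raise \<open>G\<close> at \<open>x\<close> and lower it at
  \<open>\<sigma> x\<close>.\<close>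

lemma projection_translation:
  fixes V :: "'a set"
  assumes \<delta>: "\<delta> > 0" and V: "finite V" and E: "E \<subseteq> V \<times> V"
    and G: "is_projection V \<delta> E w F G"
    and S: "S \<subseteq> V" "\<sigma> ` S \<subseteq> V" "inj_on \<sigma> S"
    and from_S: "\<And>x y. (x, y) \<in> E \<Longrightarrow> x \<in> S \<Longrightarrow> y \<in> S \<and> (\<sigma> x, \<sigma> y) \<in> E \<and> w (\<sigma> x) (\<sigma> y) = w x y"
    and into_S: "\<And>x' y. (x', \<sigma> y) \<in> E \<Longrightarrow> y \<in> S \<Longrightarrow>
           \<exists>x\<in>S. x' = \<sigma> x \<and> (x, y) \<in> E \<and> w (\<sigma> x) (\<sigma> y) = w x y"
    and F: "\<And>x. x \<in> S \<Longrightarrow> F (\<sigma> x) \<le> F x + a"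
    and x: "x \<in> S"
  shows "G (\<sigma> x) \<le> G x + a"
proof (rule ccontr)
  assume contra: "\<not> ?thesis"
  define D where "D = {x \<in> S. G (\<sigma> x) > G x + a}"
  have D: "D \<subseteq> S" "D \<noteq> {}" "finite D"
    using contra x S V by (auto simp: D_def intro: finite_subset)
  have fe: "feasible E w G"
    using G by (auto simp: is_projection_def)
  have "(\<Sum>x\<in>D. smooth_sgn \<delta> (F x - G x)) \<le> 0"
  proof (rule projection_raise[OF \<delta> V E G])
    show "D \<subseteq> V" using D S by auto
    fix x y assume xy: "(x, y) \<in> E" "x \<in> D" "y \<notin> D"
    \<comment> \<open>\<open>G x < G (\<sigma> x) - a \<le> G (\<sigma> y) + w x y - a \<le> G y + w
      x y\<close>, the last because \<open>y\<close> lies in \<open>S\<close> but not in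
      \<open>D\<close>.\<close>
    then show "G x < G y + w x y"
      using from_S[of x y] feasibleD[OF fe, of "\<sigma> x" "\<sigma> y"] by (auto simp: D_def)
  qed
  moreover have "(\<Sum>x\<in>\<sigma> ` D. smooth_sgn \<delta> (F x - G x)) \<ge> 0"
  proof (rule projection_lower[OF \<delta> V E G])
    show "\<sigma> ` D \<subseteq> V" using D S by auto
    fix x' y' assume xy: "(x', y') \<in> E" "x' \<notin> \<sigma> ` D" "y' \<in> \<sigma> ` D"
    then obtain y where y: "y \<in> D" "y' = \<sigma> y" by auto
    then obtain x where "x \<in> S" "x' = \<sigma> x" "(x, y) \<in> E" "w (\<sigma> x) (\<sigma> y) = w x y"
      using into_S[of x' y] xy(1) D by auto
    moreover from this xy(2) have "x \<notin> D" by auto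
    ultimately show "G x' < G y' + w x' y'"
      using y feasibleD[OF fe, of x y] by (auto simp: D_def)
  qed
  moreover have "(\<Sum>x\<in>\<sigma> ` D. smooth_sgn \<delta> (F x - G x)) = (\<Sum>x\<in>D. smooth_sgn \<delta> (F (\<sigma> x) - G (\<sigma> x)))"
    using S(3) D(1) by (simp add: sum.reindex inj_on_subset)
  \<comment> \<open>From \<open>x\<close> to \<open>\<sigma> x\<close> the function \<open>F\<close>
    grows by at most \<open>a\<close> and \<open>G\<close> by more than \<open>a\<close>. As
    \<open>D\<close> is nonempty, strict monotonicity contradicts the two sign conditions.\<close>
  moreover have "(\<Sum>x\<in>D. smooth_sgn \<delta> (F (\<sigma> x) - G (\<sigma> x))) < (\<Sum>x\<in>D. smooth_sgn \<delta> (F x - G x))"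
  proof (rule sum_strict_mono)
    fix x assume "x \<in> D"
    then show "smooth_sgn \<delta> (F (\<sigma> x) - G (\<sigma> x)) < smooth_sgn \<delta> (F x - G x)"
      using F[of x] by (intro smooth_sgn_less[OF \<delta>]) (auto simp: D_def)
  qed (use D in auto)
  ultimately show False by linarith
qed

section \<open>Dimension reduction on the grid\<close>

text \<open>A natural-number form of \<open>l1_dist\<close>, since distances are to count jumps.
  Truncated subtraction makes one of the two terms vanish.\<close>

definition grid_dist :: "nat \<Rightarrow> point \<Rightarrow> point \<Rightarrow> nat" where
  "grid_dist n x y = (\<Sum>i = 1..n. (x i - y i) + (y i - x i))"

lemma grid_dist_eq_l1_dist: "real (grid_dist n x y) = l1_dist n x y"
  unfolding grid_dist_def l1_dist_def of_nat_sum by (intro sum.cong) auto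

lemma l1_dist_nonneg: "l1_dist n x y \<ge> 0"
  by (simp add: l1_dist_def sum_nonneg)

lemma l1_dist_commute: "l1_dist n x y = l1_dist n y x"
  by (simp add: l1_dist_def abs_minus_commute)

lemma l1_dist_triangle: "l1_dist n x z \<le> l1_dist n x y + l1_dist n y z"
  unfolding l1_dist_def sum.distrib[symmetric] by (intro sum_mono) auto

lemma l1_dist_axis:
  assumes "i \<in> {1..n}" "y = x(i := y i)"
  shows "l1_dist n x y = \<bar>real (x i) - real (y i)\<bar>"
proof -
  have "y j = x j" if "j \<noteq> i" for j
    using assms(2) that by (metis fun_upd_other)
  then have "l1_dist n x y = (\<Sum>j = 1..n. if j = i then \<bar>real (x i) - real (y i)\<bar> else 0)"
    unfolding l1_dist_def by (intro sum.cong) auto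
  then show ?thesis using assms(1) by simp
qed

lemma grid_update: "x \<in> grid n k \<Longrightarrow> i \<in> {1..n} \<Longrightarrow> t \<in> {1..k} \<Longrightarrow> x(i := t) \<in> grid n k"
  unfolding grid_def by (auto simp: PiE_iff extensional_def)

lemma grid_coord: "x \<in> grid n k \<Longrightarrow> i \<in> {1..n} \<Longrightarrow> x i \<in> {1..k}"
  unfolding grid_def by auto

text \<open>The equation \<open>y = x(i := y i)\<close> says that the points agree off coordinate
  \<open>i\<close>. The relation is symmetric, so feasibility over it bounds differences from both
  sides.\<close>

definition axis_pairs :: "nat \<Rightarrow> nat \<Rightarrow> nat set \<Rightarrow> (point \<times> point) set" where
  "axis_pairs n k J = {(x, y). x \<in> grid n k \<and> y \<in> grid n k \<and> (\<exists>i\<in>J. y = x(i := y i))}"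

lemma axis_pairs_subset: "axis_pairs n k J \<subseteq> grid n k \<times> grid n k"
  by (auto simp: axis_pairs_def)

lemma axis_pairs_mono: "J \<subseteq> J' \<Longrightarrow> axis_pairs n k J \<subseteq> axis_pairs n k J'"
  by (auto simp: axis_pairs_def)

text \<open>The points \<open>z j\<close>, with the first \<open>j\<close> coordinates taken from
  \<open>y\<close>, lead from \<open>x\<close> to \<open>y\<close> along the axes, and the lengths
  of the moves add up to the l1 distance.\<close>

lemma axis_feasible_imp_le:
  assumes G: "feasible (axis_pairs n k {1..n}) (l1_dist n) G"
    and x: "x \<in> grid n k" and y: "y \<in> grid n k"
  shows "G x \<le> G y + l1_dist n x y"
proof -
  define z where "z j = (\<lambda>i. if i \<in> {1..j} then y i else x i)" for j :: nat
  have z_grid: "z j \<in> grid n k" if "j \<le> n" for j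
    using x y that unfolding z_def grid_def by (auto simp: PiE_iff extensional_def)
  have "G x \<le> G (z j) + (\<Sum>i = 1..j. \<bar>real (x i) - real (y i)\<bar>)" if "j \<le> n" for j
    using that
  proof (induction j)
    case 0
    then show ?case by (simp add: z_def)
  next
    case (Suc j)
    have eq: "z (Suc j) = (z j)(Suc j := z (Suc j) (Suc j))"
      by (auto simp: z_def fun_eq_iff le_Suc_eq)
    have "(z j, z (Suc j)) \<in> axis_pairs n k {1..n}"
      unfolding axis_pairs_def using Suc.prems z_grid eq by (auto intro!: bexI[of _ "Suc j"])
    from feasibleD[OF G this]
    have "G (z j) \<le> G (z (Suc j)) + \<bar>real (z j (Suc j)) - real (z (Suc j) (Suc j))\<bar>"
      using Suc.prems eq by (subst (asm) l1_dist_axis[of "Suc j"]) auto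
    then show ?case
      using Suc by (simp add: z_def)
  qed
  from this[of n] have "G x \<le> G (z n) + l1_dist n x y"
    by (simp add: l1_dist_def)
  moreover have "z n = y"
    using x y unfolding z_def grid_def by (auto simp: fun_eq_iff PiE_iff extensional_def)
  ultimately show ?thesis by simp
qed

section \<open>Projecting one direction at a time\<close>

definition axis_lipschitz :: "nat \<Rightarrow> nat \<Rightarrow> nat \<Rightarrow> point set \<Rightarrow> (point \<Rightarrow> real) \<Rightarrow> bool" where
  "axis_lipschitz n k i W F \<longleftrightarrow>
     (\<forall>x\<in>W. \<forall>y\<in>W. y = x(i := y i) \<longrightarrow> F x \<le> F y + \<bar>real (x i) - real (y i)\<bar>)"

text \<open>McShane extension on each line in direction \<open>i\<close>: the minimum of the cones
  over the points of \<open>W\<close> on the line. A line that misses \<open>W\<close> gets the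
  value \<open>0\<close>.\<close>

lemma axis_lipschitz_extension:
  assumes W: "W \<subseteq> grid n k" and F: "axis_lipschitz n k i W F"
  shows "\<exists>F'. (\<forall>x\<in>W. F' x = F x) \<and> axis_lipschitz n k i (grid n k) F'"
proof -
  define N where "N x = {z \<in> W. z = x(i := z i)}" for x
  define h where "h x z = F z + \<bar>real (x i) - real (z i)\<bar>" for x z :: point
  define F' where "F' x = (if N x = {} then 0 else Min (h x ` N x))" for x
  have fin: "finite (N x)" for x
    using W finite_grid by (auto simp: N_def intro: finite_subset)
  have "F' x = F x" if x: "x \<in> W" for x
  proof -
    have xN: "x \<in> N x" using x by (simp add: N_def)
    have "h x z \<ge> F x" if "z \<in> N x" for z
      using F x that by (auto simp: h_def N_def axis_lipschitz_def)
    moreover have "h x x = F x" by (simp add: h_def)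
    ultimately have "Min (h x ` N x) = F x"
      using xN fin by (intro Min_eqI) (auto intro: rev_image_eqI)
    then show ?thesis using xN by (auto simp: F'_def)
  qed
  moreover have "F' x \<le> F' y + \<bar>real (x i) - real (y i)\<bar>" if "y = x(i := y i)" for x y
  proof -
    have N_eq: "N x = N y"
      unfolding N_def by (subst that) simp
    show ?thesis
    proof (cases "N y = {}")
      case True
      then show ?thesis using N_eq by (simp add: F'_def)
    next
      case False
      then have "F' y \<in> h y ` N y" using fin by (simp add: F'_def)
      then obtain z where z: "z \<in> N y" "F' y = h y z" by auto
      have "F' x \<le> h x z"
        using z(1) N_eq fin False by (auto simp: F'_def)
      also have "\<dots> \<le> h y z + \<bar>real (x i) - real (y i)\<bar>"
        by (simp add: h_def)
      finally show ?thesis using z by simp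
    qed
  qed
  ultimately show ?thesis
    unfolding axis_lipschitz_def by blast
qed

lemma grid_projection_exists:
  "\<exists>G. is_projection (grid n k) \<delta> (axis_pairs n k J) (l1_dist n) F G"
  by (rule projection_exists[OF finite_grid axis_pairs_subset]) (rule l1_dist_nonneg)

text \<open>Shifting the slice \<open>z i = y i\<close> onto \<open>z i = x i\<close> preserves the
  constraints in the directions \<open>J\<close>, as \<open>i\<close> is not among them. So
  \<open>projection_translation\<close> passes the bound in direction \<open>i\<close> from
  \<open>F\<close> to \<open>G\<close>; being feasible for the larger system, \<open>G\<close> is
  optimal there too.\<close>

lemma projection_axis_lipschitz:
  assumes \<delta>: "\<delta> > 0" and i: "i \<in> {1..n}" "i \<notin> J"
    and G: "is_projection (grid n k) \<delta> (axis_pairs n k J) (l1_dist n) F G"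
    and F: "axis_lipschitz n k i (grid n k) F"
  shows "is_projection (grid n k) \<delta> (axis_pairs n k (insert i J)) (l1_dist n) F G"
proof -
  have fe: "feasible (axis_pairs n k J) (l1_dist n) G"
    using G by (simp add: is_projection_def)
  have "feasible (axis_pairs n k (insert i J)) (l1_dist n) G"
    unfolding feasible_def
  proof safe
    fix x y assume xy: "(x, y) \<in> axis_pairs n k (insert i J)"
    show "G x \<le> G y + l1_dist n x y"
    proof (cases "(x, y) \<in> axis_pairs n k J")
      case True
      then show ?thesis using feasibleD[OF fe] by blast
    next
      case False
      then have xg: "x \<in> grid n k" "y \<in> grid n k" and eq: "y = x(i := y i)"
        using xy by (auto simp: axis_pairs_def)
      define S where "S = {z \<in> grid n k. z i = y i}"
      define \<sigma> where "\<sigma> z = z(i := x i)" for z :: point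
      have \<sigma>_grid: "\<sigma> z \<in> grid n k" if "z \<in> S" for z
        using that grid_update[OF _ i(1) grid_coord[OF xg(1) i(1)]] by (simp add: S_def \<sigma>_def)
      have w: "l1_dist n (\<sigma> u) (\<sigma> v) = l1_dist n u v" if "u \<in> S" "v \<in> S" for u v
        using that unfolding l1_dist_def by (intro sum.cong) (auto simp: S_def \<sigma>_def)
      have "G (\<sigma> y) \<le> G y + \<bar>real (x i) - real (y i)\<bar>"
      proof (rule projection_translation[OF \<delta> finite_grid axis_pairs_subset G])
        show "S \<subseteq> grid n k" by (auto simp: S_def)
        show "\<sigma> ` S \<subseteq> grid n k" using \<sigma>_grid by auto
        show "inj_on \<sigma> S"
        proof (rule inj_onI)
          have "z = (\<sigma> z)(i := y i)" if "z \<in> S" for z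
            using that by (auto simp: S_def \<sigma>_def)
          then show "u = v" if "u \<in> S" "v \<in> S" "\<sigma> u = \<sigma> v" for u v
            using that by metis
        qed
        show "y \<in> S" using xg by (simp add: S_def)
        show "F (\<sigma> z) \<le> F z + \<bar>real (x i) - real (y i)\<bar>" if z: "z \<in> S" for z
        proof -
          have "z \<in> grid n k" "z i = y i" using z by (auto simp: S_def)
          moreover have "z = (\<sigma> z)(i := z i)" by (simp add: \<sigma>_def)
          moreover have "\<sigma> z i = x i" by (simp add: \<sigma>_def)
          ultimately show ?thesis
            using F \<sigma>_grid[OF z] unfolding axis_lipschitz_def by metis
        qed
        show "v \<in> S \<and> (\<sigma> u, \<sigma> v) \<in> axis_pairs n k J \<and> l1_dist n (\<sigma> u) (\<sigma> v) = l1_dist n u v"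
          if uv: "(u, v) \<in> axis_pairs n k J" "u \<in> S" for u v
        proof -
          obtain l where l: "l \<in> J" "v = u(l := v l)" and g: "v \<in> grid n k"
            using uv by (auto simp: axis_pairs_def)
          have "l \<noteq> i" using l i by auto
          then have "v i = u i" using l(2) by (metis fun_upd_other)
          then have v: "v \<in> S" using uv(2) g by (auto simp: S_def)
          have "\<sigma> v = (\<sigma> u)(l := \<sigma> v l)"
            using l(2) \<open>l \<noteq> i\<close> unfolding \<sigma>_def by (metis fun_upd_other fun_upd_twist)
          then have "(\<sigma> u, \<sigma> v) \<in> axis_pairs n k J"
            using \<sigma>_grid v uv(2) l(1) by (auto simp: axis_pairs_def)
          with v w[OF uv(2) v] show ?thesis by blast
        qed
        show "\<exists>u\<in>S. u' = \<sigma> u \<and> (u, v) \<in> axis_pairs n k J \<and> l1_dist n (\<sigma> u) (\<sigma> v) = l1_dist n u v"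
          if uv: "(u', \<sigma> v) \<in> axis_pairs n k J" "v \<in> S" for u' v
        proof -
          obtain l where l: "l \<in> J" "\<sigma> v = u'(l := \<sigma> v l)" and g: "u' \<in> grid n k"
            using uv by (auto simp: axis_pairs_def)
          have "l \<noteq> i" using l i by auto
          define u where "u = u'(i := y i)"
          have uS: "u \<in> S"
            using grid_update[OF g i(1) grid_coord[OF xg(2) i(1)]] by (simp add: S_def u_def)
          have "u' i = x i"
            using fun_cong[OF l(2), of i] \<open>l \<noteq> i\<close> by (simp add: \<sigma>_def)
          then have u': "u' = \<sigma> u" by (auto simp: u_def \<sigma>_def)
          have "v j = (u(l := v l)) j" for j
            using fun_cong[OF l(2), of j] \<open>l \<noteq> i\<close> uv(2) by (auto simp: u_def \<sigma>_def S_def)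
          then have "v = u(l := v l)" by blast
          then have "(u, v) \<in> axis_pairs n k J"
            using uS uv(2) l(1) by (auto simp: axis_pairs_def S_def)
          then show ?thesis using uS u' w[OF uS uv(2)] by blast
        qed
      qed
      moreover have "\<sigma> y = x"
        using eq unfolding \<sigma>_def by (metis fun_upd_triv fun_upd_upd)
      ultimately show ?thesis
        using l1_dist_axis[OF i(1) eq] by simp
    qed
  qed
  moreover have "feasible (axis_pairs n k J) (l1_dist n) H"
    if "feasible (axis_pairs n k (insert i J)) (l1_dist n) H" for H
    using that axis_pairs_mono[of J "insert i J" n k] by (auto simp: feasible_def)
  ultimately show ?thesis
    using G unfolding is_projection_def by blast
qed

text \<open>Correcting \<open>F\<close> on \<open>U\<close> so that it becomes Lipschitz in direction \<open>i\<close> does not disturb the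
  earlier directions, because after projecting \<^emph>\<open>without\<close> direction \<open>i\<close> one returns to the
  original \<open>F\<close>.  This keeps the losses of different directions additive.\<close>

lemma projection_add_axis:
  assumes \<delta>: "\<delta> > 0" and i: "i \<in> {1..n}" "i \<notin> J"
    and U: "U \<subseteq> grid n k" and F: "axis_lipschitz n k i (grid n k - U) F"
    and G0: "is_projection (grid n k) \<delta> (axis_pairs n k J) (l1_dist n) F G0"
    and G1: "is_projection (grid n k) \<delta> (axis_pairs n k (insert i J)) (l1_dist n) F G1"
  shows "(\<Sum>x\<in>grid n k. \<bar>smooth_sgn \<delta> (F x - G1 x)\<bar>)
           \<le> (\<Sum>x\<in>grid n k. \<bar>smooth_sgn \<delta> (F x - G0 x)\<bar>) + 8 * real (card U)"
proof -
  obtain F' where F': "\<And>x. x \<in> grid n k - U \<Longrightarrow> F' x = F x" "axis_lipschitz n k i (grid n k) F'"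
    using axis_lipschitz_extension[OF Diff_subset F] by blast
  obtain G' where G': "is_projection (grid n k) \<delta> (axis_pairs n k J) (l1_dist n) F' G'"
    using grid_projection_exists by blast
  \<comment> \<open>\<open>G'\<close> is the projection of \<open>F'\<close> both with and without
    direction \<open>i\<close>. Comparing it with \<open>G1\<close> and with \<open>G0\<close> costs
    \<open>4 * card U\<close> each.\<close>
  note G'' = projection_axis_lipschitz[OF \<delta> i G' F'(2)]
  have "(\<Sum>x\<in>grid n k. \<bar>smooth_sgn \<delta> (F x - G1 x) - smooth_sgn \<delta> (F' x - G' x)\<bar>) \<le> 4 * real (card U)"
    using F'(1) by (intro projection_stability[OF \<delta> finite_grid axis_pairs_subset G1 G'' U]) auto
  moreover have "(\<Sum>x\<in>grid n k. \<bar>smooth_sgn \<delta> (F x - G0 x) - smooth_sgn \<delta> (F' x - G' x)\<bar>) \<le> 4 * real (card U)"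
    using F'(1) by (intro projection_stability[OF \<delta> finite_grid axis_pairs_subset G0 G' U]) auto
  moreover have "(\<Sum>x\<in>grid n k. \<bar>smooth_sgn \<delta> (F x - G1 x)\<bar>) \<le>
     (\<Sum>x\<in>grid n k. \<bar>smooth_sgn \<delta> (F x - G0 x)\<bar>
       + \<bar>smooth_sgn \<delta> (F x - G1 x) - smooth_sgn \<delta> (F' x - G' x)\<bar>
       + \<bar>smooth_sgn \<delta> (F x - G0 x) - smooth_sgn \<delta> (F' x - G' x)\<bar>)"
    by (intro sum_mono) linarith
  ultimately show ?thesis
    by (simp add: sum.distrib)
qed

lemma projection_sgn_sum_le:
  assumes \<delta>: "\<delta> > 0" and J: "J \<subseteq> {1..n}"
    and U: "\<And>i. i \<in> J \<Longrightarrow> U i \<subseteq> grid n k"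
    and F: "\<And>i. i \<in> J \<Longrightarrow> axis_lipschitz n k i (grid n k - U i) F"
    and G: "is_projection (grid n k) \<delta> (axis_pairs n k J) (l1_dist n) F G"
  shows "(\<Sum>x\<in>grid n k. \<bar>smooth_sgn \<delta> (F x - G x)\<bar>) \<le> 8 * (\<Sum>i\<in>J. real (card (U i)))"
proof -
  have "finite J" using J finite_subset by blast
  then show ?thesis
    using J U F G
  proof (induction J arbitrary: G)
    case empty
    note pr = \<delta> finite_grid axis_pairs_subset empty.prems(4)
    \<comment> \<open>Without constraints a single point may be both raised and lowered.\<close>
    have "smooth_sgn \<delta> (F x - G x) = 0" if x: "x \<in> grid n k" for x
    proof (rule antisym)
      show "smooth_sgn \<delta> (F x - G x) \<le> 0"
        using projection_raise[OF pr, of "{x}"] x by (simp add: axis_pairs_def)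
      show "0 \<le> smooth_sgn \<delta> (F x - G x)"
        using projection_lower[OF pr, of "{x}"] x by (simp add: axis_pairs_def)
    qed
    then show ?case by simp
  next
    case (insert i J)
    obtain G0 where G0: "is_projection (grid n k) \<delta> (axis_pairs n k J) (l1_dist n) F G0"
      using grid_projection_exists by blast
    have "(\<Sum>x\<in>grid n k. \<bar>smooth_sgn \<delta> (F x - G0 x)\<bar>) \<le> 8 * (\<Sum>i\<in>J. real (card (U i)))"
      using insert.prems by (intro insert.IH G0) auto
    moreover have "(\<Sum>x\<in>grid n k. \<bar>smooth_sgn \<delta> (F x - G x)\<bar>)
        \<le> (\<Sum>x\<in>grid n k. \<bar>smooth_sgn \<delta> (F x - G0 x)\<bar>) + 8 * real (card (U i))"
      using insert.prems insert.hyps by (intro projection_add_axis[OF \<delta> _ _ _ _ G0]) auto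
    ultimately show ?case
      using insert.hyps by simp
  qed
qed

theorem dimension_reduction:
  assumes U: "\<And>i. i \<in> {1..n} \<Longrightarrow> U i \<subseteq> grid n k"
    and F: "\<And>i. i \<in> {1..n} \<Longrightarrow> axis_lipschitz n k i (grid n k - U i) F"
  shows "\<exists>S\<subseteq>grid n k. real (card S) \<le> 16 * (\<Sum>i = 1..n. real (card (U i))) \<and>
           (\<forall>x\<in>grid n k - S. \<forall>y\<in>grid n k - S. \<bar>F x - F y\<bar> \<le> l1_dist n x y)"
proof -
  \<comment> \<open>\<open>gap\<close> is half the amount by which a pair is violated, and
    \<open>\<delta>\<close> is at most every positive gap. So the ends of a violated pair cannot
    both be within less than \<open>\<delta>\<close> of the Lipschitz \<open>G\<close>. The
    \<open>1\<close> is the default when nothing is violated.\<close>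
  define gap where "gap = (\<lambda>(x, y). (\<bar>F x - F y\<bar> - l1_dist n x y) / 2)"
  define P where "P = {e \<in> grid n k \<times> grid n k. gap e > 0}"
  define \<delta> where "\<delta> = Min (insert 1 (gap ` P))"
  have finP: "finite P" by (simp add: P_def finite_grid)
  then have \<delta>: "\<delta> > 0" by (auto simp: \<delta>_def P_def)
  have \<delta>_le: "\<delta> \<le> gap e" if "e \<in> P" for e
    using that finP by (simp add: \<delta>_def)
  obtain G where G: "is_projection (grid n k) \<delta> (axis_pairs n k {1..n}) (l1_dist n) F G"
    using grid_projection_exists by blast
  have fe: "feasible (axis_pairs n k {1..n}) (l1_dist n) G"
    using G by (simp add: is_projection_def)
  define S where "S = {x \<in> grid n k. \<bar>F x - G x\<bar> \<ge> \<delta>}"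
  \<comment> \<open>Each point of \<open>S\<close> contributes at least 1/2 to the sum, which
    doubles the factor 8.\<close>
  have "real (card S) / 2 = (\<Sum>x\<in>S. 1 / 2)" by simp
  also have "\<dots> \<le> (\<Sum>x\<in>S. \<bar>smooth_sgn \<delta> (F x - G x)\<bar>)"
    by (intro sum_mono abs_smooth_sgn_ge_half[OF \<delta>]) (auto simp: S_def)
  also have "\<dots> \<le> (\<Sum>x\<in>grid n k. \<bar>smooth_sgn \<delta> (F x - G x)\<bar>)"
    by (intro sum_mono2 finite_grid) (auto simp: S_def)
  also have "\<dots> \<le> 8 * (\<Sum>i = 1..n. real (card (U i)))"
    using U F by (intro projection_sgn_sum_le[OF \<delta> subset_refl _ _ G]) auto
  finally have card: "real (card S) \<le> 16 * (\<Sum>i = 1..n. real (card (U i)))" by simp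
  have "\<bar>F x - F y\<bar> \<le> l1_dist n x y" if x: "x \<in> grid n k - S" and y: "y \<in> grid n k - S" for x y
  proof (rule ccontr)
    assume "\<not> ?thesis"
    then have "\<delta> \<le> gap (x, y)" using x y by (intro \<delta>_le) (auto simp: P_def gap_def)
    then have "\<bar>F x - F y\<bar> \<ge> l1_dist n x y + 2 * \<delta>" by (simp add: gap_def)
    moreover have "\<bar>F x - G x\<bar> < \<delta>" "\<bar>F y - G y\<bar> < \<delta>" using x y by (auto simp: S_def)
    moreover have "G x \<le> G y + l1_dist n x y"
      using axis_feasible_imp_le[OF fe] x y by blast
    moreover have "G y \<le> G x + l1_dist n x y"
      using axis_feasible_imp_le[OF fe, of y x] x y by (simp add: l1_dist_commute)
    ultimately show False by linarith
  qed
  then show ?thesis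
    using card by (intro exI[of _ S]) (auto simp: S_def)
qed

section \<open>The tester\<close>

definition levels :: "nat \<Rightarrow> nat" where
  "levels k = (LEAST l. k < 2 ^ l)"

text \<open>At each level \<open>j\<close> these are the multiple of \<open>2 ^ j\<close> at or
  below \<open>t\<close> and the next one; those outside the line are dropped.\<close>

definition probes :: "nat \<Rightarrow> nat \<Rightarrow> nat list" where
  "probes k t = filter (\<lambda>p. p \<in> {1..k})
     (map (\<lambda>j. (t div 2 ^ j) * 2 ^ j) [0..<levels k] @ map (\<lambda>j. (t div 2 ^ j + 1) * 2 ^ j) [0..<levels k])"

lemma less_power_levels: "k < 2 ^ levels k"
  unfolding levels_def by (rule LeastI[of _ k]) (rule less_exp)

text \<open>\<open>levels k\<close> is the number of binary digits of \<open>k\<close>, at most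
  \<open>log 2 k + 1\<close>; for \<open>k \<ge> 2\<close> the summand 1 is absorbed by the factor
  2.\<close>

lemma levels_le_log:
  assumes "k \<ge> 2"
  shows "real (levels k) \<le> 2 * log 2 (real k)"
proof -
  have "levels k \<noteq> 0" using less_power_levels[of k] assms by (auto intro: ccontr)
  then obtain l where l: "levels k = Suc l" using not0_implies_Suc by blast
  then have "\<not> k < 2 ^ l"
    unfolding levels_def by (metis lessI not_less_Least)
  then have "real (2 ^ l) \<le> real k" by (subst of_nat_le_iff) simp
  then have "real l \<le> log 2 (real k)"
    using assms by (simp add: le_log_iff powr_realpow)
  moreover have "1 \<le> log 2 (real k)"
    using assms by (simp add: le_log_iff)
  ultimately show ?thesis using l by simp
qed

lemma set_probes: "set (probes k t) \<subseteq> {1..k}"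
  by (auto simp: probes_def)

lemma length_probes: "length (probes k t) \<le> 2 * levels k"
  unfolding probes_def by (rule order_trans[OF length_filter_le]) simp

text \<open>This is a probe of level 0. It makes a sampled point one of its own queries, so that its
  value can be compared with the others.\<close>

lemma self_in_probes:
  assumes "t \<in> {1..k}"
  shows "t \<in> set (probes k t)"
proof -
  have "levels k \<noteq> 0" using less_power_levels[of k] assms by (auto intro: ccontr)
  then have "\<exists>j\<in>{0..<levels k}. t = (t div 2 ^ j) * 2 ^ j"
    by (intro bexI[of _ 0]) auto
  with assms show ?thesis by (auto simp: probes_def)
qed

text \<open>The common probe is the largest multiple of \<open>2 ^ j\<close> below \<open>y\<close>, where \<open>j\<close> is the highest
  binary digit in which \<open>x\<close> and \<open>y\<close> differ.\<close>

lemma common_probe: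
  assumes x: "1 \<le> x" "x < y" "y \<le> k"
  shows "\<exists>z. z \<in> set (probes k x) \<and> z \<in> set (probes k y) \<and> x \<le> z \<and> z \<le> y"
proof -
  define J where "J = (LEAST J. x div 2 ^ J = y div 2 ^ J)"
  have lev: "x div 2 ^ levels k = y div 2 ^ levels k"
    using less_power_levels[of k] x by simp
  then have J: "x div 2 ^ J = y div 2 ^ J" "J \<le> levels k"
    unfolding J_def by (rule LeastI, rule Least_le)
  have "J \<noteq> 0" using J(1) x by (auto intro: ccontr)
  then obtain j where j: "J = Suc j" using not0_implies_Suc by blast
  define a where "a = x div 2 ^ j"
  define b where "b = y div 2 ^ j"
  have "a \<noteq> b"
    unfolding a_def b_def using j not_less_Least[of j "\<lambda>J. x div 2 ^ J = y div 2 ^ J"]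
    unfolding J_def by simp
  moreover have "a \<le> b" using x by (simp add: a_def b_def div_le_mono)
  moreover have "a div 2 = b div 2"
    using J(1) unfolding a_def b_def j by (simp add: div_mult2_eq[symmetric] mult.commute)
  \<comment> \<open>\<open>a\<close> and \<open>b\<close> differ but have the same half, so they are
    consecutive; \<open>z\<close> is then the next multiple of \<open>2 ^ j\<close> above
    \<open>x\<close> and the last one at or below \<open>y\<close>.\<close>
  ultimately have b: "b = a + 1" by linarith
  define z where "z = b * 2 ^ j"
  have "z \<le> y" by (simp add: z_def b_def)
  have "x < z"
    unfolding z_def b a_def
    by (metis Suc_eq_plus1 dividend_less_div_times mult.commute mult_Suc add.commute zero_less_numeral zero_less_power)
  moreover have z_range: "z \<in> {1..k}"
    using \<open>z \<le> y\<close> \<open>x < z\<close> x by simp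
  have "z \<in> (\<lambda>j. (y div 2 ^ j) * 2 ^ j) ` {0..<levels k}"
    using J(2) j by (intro image_eqI[of _ _ j]) (simp_all add: z_def b_def)
  then have "z \<in> set (probes k y)"
    using z_range by (simp add: probes_def)
  moreover have "z \<in> (\<lambda>j. (x div 2 ^ j + 1) * 2 ^ j) ` {0..<levels k}"
    using J(2) j by (intro image_eqI[of _ _ j]) (simp_all add: z_def b a_def)
  then have "z \<in> set (probes k x)"
    using z_range by (simp add: probes_def)
  ultimately show ?thesis using \<open>z \<le> y\<close> by (intro exI[of _ z]) simp
qed

section \<open>Violations along lines and the distance to the property\<close>

lemma lipschitz_jump_reach_up:
  assumes c: "c > 0" and g: "g \<in> grid n k \<rightarrow> R" "c_lipschitz n k c g"
    and x: "x \<in> grid n k" "i \<in> {1..n}" "x i + m \<le> k"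
  shows "jump_reach R c m (g x) (g (x(i := x i + m)))"
  using x(3)
proof (induction m)
  case 0
  then show ?case by simp
next
  case (Suc m)
  define y where "y = x(i := x i + m)"
  define z where "z = x(i := x i + Suc m)"
  have "x i \<ge> 1" using grid_coord[OF x(1,2)] by simp
  then have yz: "y \<in> grid n k" "z \<in> grid n k"
    unfolding y_def z_def using Suc.prems by (auto intro!: grid_update x)
  have "l1_dist n y z = 1"
    by (subst l1_dist_axis[OF x(2)]) (auto simp: y_def z_def)
  then have "\<bar>g y - g z\<bar> \<le> c"
    using g(2) yz unfolding c_lipschitz_def by fastforce
  then have "jump_reach R c (Suc 0) (g y) (g z)"
    using g(1) yz by (intro jump_reach_1) auto
  moreover have "jump_reach R c m (g x) (g y)"
    unfolding y_def by (rule Suc.IH) (use Suc.prems in simp)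
  ultimately have "jump_reach R c (m + Suc 0) (g x) (g z)"
    by (intro jump_reach_add)
  then show ?case
    by (simp only: z_def add_Suc_right add_0_right)
qed

text \<open>Each unit step along the line is a jump of length at most \<open>c\<close> between
  values in \<open>R\<close>. Hence a pair without a chain refutes the property, even if its
  difference alone is small enough.\<close>

lemma lipschitz_jump_reach:
  assumes c: "c > 0" and g: "g \<in> grid n k \<rightarrow> R" "c_lipschitz n k c g"
    and x: "x \<in> grid n k" "i \<in> {1..n}" "t \<in> {1..k}"
  shows "jump_reach R c (grid_dist n x (x(i := t))) (g x) (g (x(i := t)))"
proof -
  have dist: "real (grid_dist n x (x(i := t))) = \<bar>real (x i) - real t\<bar>"
    unfolding grid_dist_eq_l1_dist by (subst l1_dist_axis[OF x(2)]) auto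
  have y: "x(i := t) \<in> grid n k" by (rule grid_update[OF x])
  show ?thesis
  proof (cases "x i \<le> t")
    case True
    then have "grid_dist n x (x(i := t)) = t - x i" using dist by linarith
    then show ?thesis
      using lipschitz_jump_reach_up[OF c g x(1,2), of "t - x i"] x(3) True by simp
  next
    case False
    then have "grid_dist n x (x(i := t)) = x i - t" using dist by linarith
    moreover have "jump_reach R c (x i - t) (g (x(i := t))) (g x)"
      using lipschitz_jump_reach_up[OF c g y x(2), of "x i - t"] False grid_coord[OF x(1,2)] by simp
    ultimately show ?thesis
      using jump_reach_sym g(1) y by (metis PiE)
  qed
qed

text \<open>Violations are judged by chains in \<open>R\<close>, the condition under which
  \<open>jump_extension\<close> can repair \<open>f\<close> with values in \<open>R\<close>.\<close>

definition bad_points ::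
  "nat \<Rightarrow> nat \<Rightarrow> real \<Rightarrow> real set \<Rightarrow> (point \<Rightarrow> real) \<Rightarrow> nat \<Rightarrow> point set" where
  "bad_points n k c R f i = {x \<in> grid n k. \<exists>t\<in>set (probes k (x i)).
     \<not> jump_reach R c (grid_dist n x (x(i := t))) (f x) (f (x(i := t)))}"

lemma grid_dist_le:
  assumes "x \<in> grid n k" "y \<in> grid n k"
  shows "grid_dist n x y \<le> n * k"
proof -
  have "grid_dist n x y \<le> (\<Sum>i = 1..n. k)"
    unfolding grid_dist_def
  proof (rule sum_mono)
    fix i assume "i \<in> {1..n}"
    then show "x i - y i + (y i - x i) \<le> k"
      using grid_coord[OF assms(1)] grid_coord[OF assms(2)] by fastforce
  qed
  then show ?thesis by simp
qed

text \<open>An embedding of the values of \<open>f\<close> turns chains into real inequalities. Off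
  the bad points every line is Lipschitz, so \<open>dimension_reduction\<close> gives a set
  \<open>S\<close> that covers all violations; \<open>f\<close> is kept off \<open>S\<close> and
  redefined on it by \<open>jump_extension\<close>.\<close>

lemma lipschitz_distance_le_bad_points:
  assumes k: "k \<ge> 1" and c: "c > 0" and f: "f \<in> grid n k \<rightarrow> R"
  shows "lipschitz_distance n k c R f \<le> 16 * (\<Sum>i = 1..n. real (card (bad_points n k c R f i))) / real k ^ n"
proof -
  have fin: "finite (f ` grid n k)" "f ` grid n k \<subseteq> R"
    using f finite_grid by auto
  obtain \<phi> :: "real \<Rightarrow> real" where \<phi>: "\<forall>a\<in>f ` grid n k. \<forall>b\<in>f ` grid n k. \<forall>m\<le>n * k.
      jump_reach R c m a b \<longleftrightarrow> \<bar>\<phi> a - \<phi> b\<bar> \<le> real m"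
    using jump_embedding_iff[OF c fin] by blast
  define F where "F x = \<phi> (f x)" for x
  have F: "jump_reach R c (grid_dist n x y) (f x) (f y) \<longleftrightarrow> \<bar>F x - F y\<bar> \<le> l1_dist n x y"
    if "x \<in> grid n k" "y \<in> grid n k" for x y
    using \<phi> that grid_dist_le[OF that] by (simp add: F_def grid_dist_eq_l1_dist)
  have "axis_lipschitz n k i (grid n k - bad_points n k c R f i) F" if i: "i \<in> {1..n}" for i
    unfolding axis_lipschitz_def
  proof (intro ballI impI)
    fix x y
    assume x: "x \<in> grid n k - bad_points n k c R f i" and y: "y \<in> grid n k - bad_points n k c R f i"
      and eq: "y = x(i := y i)"
    have probe: "\<bar>F u - F (u(i := t))\<bar> \<le> \<bar>real (u i) - real t\<bar>"
      if u: "u \<in> grid n k - bad_points n k c R f i" and t: "t \<in> set (probes k (u i))" for u t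
    proof -
      have "u(i := t) \<in> grid n k"
        using u t set_probes by (intro grid_update i) blast+
      then have "\<bar>F u - F (u(i := t))\<bar> \<le> l1_dist n u (u(i := t))"
        using u t F by (auto simp: bad_points_def)
      also have "\<dots> = \<bar>real (u i) - real t\<bar>"
        by (subst l1_dist_axis[OF i]) auto
      finally show ?thesis .
    qed
    have "x i \<in> {1..k}" "y i \<in> {1..k}" using x y i grid_coord by blast+
    then have "\<exists>z. z \<in> set (probes k (x i)) \<and> z \<in> set (probes k (y i)) \<and>
            (x i \<le> z \<and> z \<le> y i \<or> y i \<le> z \<and> z \<le> x i)"
      using common_probe[of "x i" "y i" k] common_probe[of "y i" "x i" k] self_in_probes[of "x i" k]
      by (cases "x i" "y i" rule: linorder_cases) fastforce+
    then obtain z where z: "z \<in> set (probes k (x i))" "z \<in> set (probes k (y i))"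
      "x i \<le> z \<and> z \<le> y i \<or> y i \<le> z \<and> z \<le> x i" by blast
    \<comment> \<open>The common probe lies between the two points, so their distances to it add up
      to their distance.\<close>
    have "y(i := z) = x(i := z)" by (subst eq) simp
    then show "F x \<le> F y + \<bar>real (x i) - real (y i)\<bar>"
      using probe[OF x z(1)] probe[OF y z(2)] z(3) by auto
  qed
  then obtain S where S: "S \<subseteq> grid n k"
    "real (card S) \<le> 16 * (\<Sum>i = 1..n. real (card (bad_points n k c R f i)))"
    "\<And>x y. x \<in> grid n k - S \<Longrightarrow> y \<in> grid n k - S \<Longrightarrow> \<bar>F x - F y\<bar> \<le> l1_dist n x y"
    using dimension_reduction[of n "bad_points n k c R f" k F] by (auto simp: bad_points_def)
  have "(\<lambda>_\<in>{1..n}. 1) \<in> grid n k" using k by (auto simp: grid_def)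
  then have "R \<noteq> {}" using f by auto
  have "\<exists>g. (\<forall>x\<in>grid n k - S. g x = f x) \<and> g \<in> (grid n k - S) \<union> S \<rightarrow> R \<and>
      (\<forall>x\<in>(grid n k - S) \<union> S. \<forall>y\<in>(grid n k - S) \<union> S. jump_reach R c (grid_dist n x y) (g x) (g y))"
  proof (rule jump_extension[OF c \<open>R \<noteq> {}\<close>])
    show "grid_dist n x x = 0" for x by (simp add: grid_dist_def)
    show "grid_dist n x y = grid_dist n y x" for x y by (simp add: grid_dist_def add.commute)
    show "grid_dist n x z \<le> grid_dist n x y + grid_dist n y z" for x y z
      using l1_dist_triangle[of n x z y] unfolding grid_dist_eq_l1_dist[symmetric] by linarith
    show "finite (grid n k - S)" "finite S"
      using finite_grid S(1) finite_subset by blast+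
    show "f \<in> grid n k - S \<rightarrow> R" using f by auto
    show "jump_reach R c (grid_dist n x y) (f x) (f y)" if "x \<in> grid n k - S" "y \<in> grid n k - S" for x y
      using F S(3)[OF that] that by simp
  qed
  moreover have "(grid n k - S) \<union> S = grid n k" using S(1) by auto
  ultimately obtain g where g: "\<forall>x\<in>grid n k - S. g x = f x" "g \<in> grid n k \<rightarrow> R"
    "\<forall>x\<in>grid n k. \<forall>y\<in>grid n k. jump_reach R c (grid_dist n x y) (g x) (g y)" by auto
  have "c_lipschitz n k c g"
    unfolding c_lipschitz_def grid_dist_eq_l1_dist[symmetric]
    using g(3) jump_reach_bound by blast
  then have "lipschitz_distance n k c R f \<le> real (card {x \<in> grid n k. f x \<noteq> g x}) / real k ^ n"
    unfolding lipschitz_distance_def using g(2)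
    by (intro Min_le finite_lipschitz_distance_values) auto
  also have "card {x \<in> grid n k. f x \<noteq> g x} \<le> card S"
  proof (rule card_mono)
    show "finite S" using S(1) finite_grid by (rule finite_subset)
    show "{x \<in> grid n k. f x \<noteq> g x} \<subseteq> S"
      using g(1) by (metis (mono_tags, lifting) DiffI mem_Collect_eq subsetI)
  qed
  then have "real (card {x \<in> grid n k. f x \<noteq> g x}) / real k ^ n \<le> real (card S) / real k ^ n"
    by (intro divide_right_mono) auto
  also have "\<dots> \<le> 16 * (\<Sum>i = 1..n. real (card (bad_points n k c R f i))) / real k ^ n"
    using S(2) by (intro divide_right_mono) auto
  finally show ?thesis .
qed

section \<open>The tester as a distribution over non-adaptive algorithms\<close>

primrec ask_all :: "point list \<Rightarrow> (real list \<Rightarrow> bool) \<Rightarrow> query_algorithm" where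
  "ask_all [] P = Stop (P [])"
| "ask_all (x # xs) P = Query x (\<lambda>r. ask_all xs (\<lambda>rs. P (r # rs)))"

lemma accepts_ask_all [simp]: "accepts (ask_all xs P) f \<longleftrightarrow> P (map f xs)"
  by (induction xs arbitrary: P) auto

lemma queries_ask_all [simp]: "queries (ask_all xs P) f = xs"
  by (induction xs arbitrary: P) auto

text \<open>The verdict asks whether some Lipschitz function with values in \<open>R\<close> fits
  all answers. One-sidedness is then automatic: a Lipschitz \<open>f\<close> is its own
  witness.\<close>

definition consistent :: "nat \<Rightarrow> nat \<Rightarrow> real \<Rightarrow> real set \<Rightarrow> point list \<Rightarrow> real list \<Rightarrow> bool" where
  "consistent n k c R xs rs \<longleftrightarrow> (\<exists>g\<in>grid n k \<rightarrow> R. c_lipschitz n k c g \<and> map g xs = rs)"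

definition sample_queries :: "nat \<Rightarrow> nat \<times> point \<Rightarrow> point list" where
  "sample_queries k = (\<lambda>(i, x). map (\<lambda>t. x(i := t)) (probes k (x i)))"

text \<open>The uniform distribution on these lists amounts to \<open>N\<close> independent draws,
  with repetition, of a direction and a point.\<close>

definition sample_lists :: "nat \<Rightarrow> nat \<Rightarrow> nat \<Rightarrow> (nat \<times> point) list set" where
  "sample_lists n k N = {ss. set ss \<subseteq> {1..n} \<times> grid n k \<and> length ss = N}"

definition sample_algorithm ::
  "nat \<Rightarrow> nat \<Rightarrow> real \<Rightarrow> real set \<Rightarrow> (nat \<times> point) list \<Rightarrow> query_algorithm" where
  "sample_algorithm n k c R ss =
     (let xs = concat (map (sample_queries k) ss) in ask_all xs (consistent n k c R xs))"

definition line_tester :: "nat \<Rightarrow> nat \<Rightarrow> real \<Rightarrow> real set \<Rightarrow> nat \<Rightarrow> randomized_algorithm" where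
  "line_tester n k c R N = map_pmf (sample_algorithm n k c R) (pmf_of_set (sample_lists n k N))"

lemma finite_samples: "finite ({1..n} \<times> grid n k)"
  by (simp add: finite_grid)

lemma card_samples: "card ({1..n} \<times> grid n k) = n * k ^ n"
  by (simp add: card_cartesian_product grid_def card_PiE)

lemma finite_sample_lists: "finite (sample_lists n k N)"
  unfolding sample_lists_def by (rule finite_lists_length_eq[OF finite_samples])

lemma card_sample_lists: "card (sample_lists n k N) = (n * k ^ n) ^ N"
  by (simp only: sample_lists_def card_lists_length_eq[OF finite_samples] card_samples)

lemma sample_lists_nonempty: "n \<ge> 1 \<Longrightarrow> k \<ge> 1 \<Longrightarrow> sample_lists n k N \<noteq> {}"
  using card_sample_lists[of n k N] by auto

lemma set_line_tester:
  assumes "n \<ge> 1" "k \<ge> 1"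
  shows "set_pmf (line_tester n k c R N) = sample_algorithm n k c R ` sample_lists n k N"
  using sample_lists_nonempty[OF assms] finite_sample_lists by (simp add: line_tester_def)

lemma queries_sample_algorithm:
  "queries (sample_algorithm n k c R ss) f = concat (map (sample_queries k) ss)"
  by (simp add: sample_algorithm_def Let_def)

lemma length_sample_queries: "length (sample_queries k s) \<le> 2 * levels k"
  by (cases s) (simp add: sample_queries_def length_probes)

lemma length_queries_sample_algorithm:
  "length (queries (sample_algorithm n k c R ss) f) \<le> length ss * (2 * levels k)"
  unfolding queries_sample_algorithm
proof (induction ss)
  case (Cons s ss)
  then show ?case using length_sample_queries[of k s] by simp
qed simp

lemma queries_sample_algorithm_in_grid:
  assumes "ss \<in> sample_lists n k N"
  shows "set (queries (sample_algorithm n k c R ss) f) \<subseteq> grid n k"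
proof -
  have "set (sample_queries k (i, x)) \<subseteq> grid n k" if "(i, x) \<in> set ss" for i x
    using that assms set_probes[of k "x i"]
    by (auto simp: sample_queries_def sample_lists_def intro!: grid_update)
  then show ?thesis
    by (auto simp: queries_sample_algorithm)
qed

lemma sample_algorithm_accepts_lipschitz:
  "f \<in> grid n k \<rightarrow> R \<Longrightarrow> c_lipschitz n k c f \<Longrightarrow> accepts (sample_algorithm n k c R ss) f"
  by (auto simp: sample_algorithm_def Let_def consistent_def)

text \<open>A Lipschitz \<open>g\<close> that fits the answers would agree with \<open>f\<close> at
  \<open>x\<close> and at the violating probe, and walking along the line would give the missing
  chain.\<close>

lemma sample_algorithm_rejects_bad:
  assumes c: "c > 0" and s: "(i, x) \<in> set ss" "i \<in> {1..n}" and bad: "x \<in> bad_points n k c R f i"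
  shows "\<not> accepts (sample_algorithm n k c R ss) f"
proof
  assume "accepts (sample_algorithm n k c R ss) f"
  then obtain g where g: "g \<in> grid n k \<rightarrow> R" "c_lipschitz n k c g"
    and eq: "\<And>s y. s \<in> set ss \<Longrightarrow> y \<in> set (sample_queries k s) \<Longrightarrow> g y = f y"
    by (auto simp: sample_algorithm_def Let_def consistent_def)
  obtain t where x: "x \<in> grid n k" and t: "t \<in> set (probes k (x i))"
    and not: "\<not> jump_reach R c (grid_dist n x (x(i := t))) (f x) (f (x(i := t)))"
    using bad by (auto simp: bad_points_def)
  have "x i \<in> set (probes k (x i))"
    by (rule self_in_probes[OF grid_coord[OF x s(2)]])
  then have "g (x(i := x i)) = f (x(i := x i))"
    by (intro eq[OF s(1)]) (simp only: sample_queries_def split set_map, blast)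
  moreover have "g (x(i := t)) = f (x(i := t))"
    using t by (intro eq[OF s(1)]) (simp add: sample_queries_def)
  moreover have "jump_reach R c (grid_dist n x (x(i := t))) (g x) (g (x(i := t)))"
    using set_probes t by (intro lipschitz_jump_reach[OF c g x s(2)]) blast
  ultimately show False using not by simp
qed

text \<open>\<open>p\<close> is the probability that a random direction and point form a bad pair.
  Acceptance requires all \<open>N\<close> draws to avoid these pairs, which has probability
  \<open>(1 - p) ^ N\<close>.\<close>

lemma line_tester_acceptance_le:
  fixes R :: "real set" and f :: "point \<Rightarrow> real"
  assumes n: "n \<ge> 1" and k: "k \<ge> 1" and c: "c > 0"
  defines "p \<equiv> (\<Sum>i = 1..n. real (card (bad_points n k c R f i))) / (real n * real k ^ n)"
  shows "measure_pmf.prob (line_tester n k c R N) {A. accepts A f} \<le> exp (- p * real N)"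
proof -
  define V where "V = {1..n} \<times> grid n k"
  define B where "B = Sigma {1..n} (bad_points n k c R f)"
  have B: "B \<subseteq> V" by (auto simp: B_def V_def bad_points_def)
  have "finite V"
    unfolding V_def by (rule finite_samples)
  note fin = this finite_subset[OF B this]
  have cV: "card V = n * k ^ n" by (simp only: V_def card_samples)
  have cB: "card B = (\<Sum>i = 1..n. card (bad_points n k c R f i))"
    unfolding B_def
    by (rule card_SigmaI) (auto simp: bad_points_def finite_grid)
  have V0: "real (card V) > 0" using n k cV by simp
  have p: "p = real (card B) / real (card V)"
    by (simp add: p_def cB cV)
  have "sample_lists n k N \<inter> {ss. accepts (sample_algorithm n k c R ss) f}
          \<subseteq> {ss. set ss \<subseteq> V - B \<and> length ss = N}"
    using sample_algorithm_rejects_bad[OF c]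
    by (fastforce simp: sample_lists_def V_def B_def)
  then have "card (sample_lists n k N \<inter> {ss. accepts (sample_algorithm n k c R ss) f})
               \<le> card {ss. set ss \<subseteq> V - B \<and> length ss = N}"
    using fin by (intro card_mono finite_lists_length_eq) auto
  also have "\<dots> = (card V - card B) ^ N"
    using fin B by (simp add: card_lists_length_eq card_Diff_subset)
  finally have le: "real (card (sample_lists n k N \<inter> {ss. accepts (sample_algorithm n k c R ss) f}))
      \<le> (real (card V) - real (card B)) ^ N"
    using card_mono[OF fin(1) B] by (metis of_nat_diff of_nat_le_iff of_nat_power)
  have "measure_pmf.prob (line_tester n k c R N) {A. accepts A f}
      = real (card (sample_lists n k N \<inter> {ss. accepts (sample_algorithm n k c R ss) f})) / real (card V) ^ N"
    unfolding line_tester_def measure_map_pmf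
    using sample_lists_nonempty[OF n k] finite_sample_lists
    by (simp add: measure_pmf_of_set vimage_def card_sample_lists cV)
  also have "\<dots> \<le> (real (card V) - real (card B)) ^ N / real (card V) ^ N"
    using le by (intro divide_right_mono) auto
  also have "\<dots> = (1 - p) ^ N"
    using V0 by (simp add: power_divide[symmetric] diff_divide_distrib p)
  also have "\<dots> \<le> exp (- p) ^ N"
  proof (rule power_mono)
    show "1 - p \<le> exp (- p)" using exp_ge_add_one_self[of "- p"] by simp
    have "real (card B) \<le> real (card V)" using card_mono[OF fin(1) B] by simp
    then show "0 \<le> 1 - p" using V0 by (simp add: p)
  qed
  also have "\<dots> = exp (- p * real N)"
    by (simp add: exp_of_nat_mult[symmetric] mult.commute)
  finally show ?thesis .
qed

lemma line_tester_correct: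
  assumes n: "n \<ge> 1" and k: "k \<ge> 1" and c: "c > 0" and \<epsilon>: "0 < \<epsilon>" and N: "real N \<ge> 32 * real n / \<epsilon>"
  shows "one_sided_lipschitz_tester n k c R \<epsilon> (line_tester n k c R N)"
  unfolding one_sided_lipschitz_tester_def
proof (intro ballI conjI impI)
  fix f assume f: "f \<in> grid n k \<rightarrow> R"
  show "set (queries A f) \<subseteq> grid n k" if "A \<in> set_pmf (line_tester n k c R N)" for A
    using that queries_sample_algorithm_in_grid unfolding set_line_tester[OF n k] by blast
  show "measure_pmf.prob (line_tester n k c R N) {A. accepts A f} = 1" if "c_lipschitz n k c f"
    using sample_algorithm_accepts_lipschitz[OF f that]
    by (subst measure_pmf.prob_eq_1) (auto simp: AE_measure_pmf_iff set_line_tester[OF n k])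
  assume far: "lipschitz_distance n k c R f > \<epsilon>"
  define b where "b = (\<Sum>i = 1..n. real (card (bad_points n k c R f i))) / real k ^ n"
  \<comment> \<open>The choice of \<open>N\<close> makes the expected number of bad draws,
    \<open>b / n * N\<close>, exceed 2, and \<open>exp (- 2)\<close> is at most 1/3.\<close>
  have "\<epsilon> < 16 * b"
    using lipschitz_distance_le_bad_points[OF k c f] far by (simp add: b_def)
  then have "(\<epsilon> / 16) * (32 * real n / \<epsilon>) < b * (32 * real n / \<epsilon>)"
    using \<epsilon> n by (intro mult_strict_right_mono) auto
  then have "2 * real n < b * (32 * real n / \<epsilon>)" using \<epsilon> by simp
  also have "\<dots> \<le> b * real N"
    using N \<open>\<epsilon> < 16 * b\<close> \<epsilon> by (intro mult_left_mono) auto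
  finally have "2 < b / real n * real N"
    using n by (simp add: field_simps)
  then have "exp (- (b / real n) * real N) < exp (- 2)" by simp
  also have "\<dots> \<le> (1 / 3 :: real)"
    using exp_ge_add_one_self[of 2] by (simp add: exp_minus field_simps)
  finally have "measure_pmf.prob (line_tester n k c R N) {A. accepts A f} < 1 / 3"
    using line_tester_acceptance_le[OF n k c, where R = R and f = f and N = N] by (simp add: b_def mult.commute)
  moreover have "{A. \<not> accepts A f} = UNIV - {A. accepts A f}" by auto
  ultimately show "measure_pmf.prob (line_tester n k c R N) {A. \<not> accepts A f} > 2 / 3"
    using measure_pmf.prob_compl[of "{A. accepts A f}" "line_tester n k c R N"] by simp
qed

text \<open>For \<open>k = 1\<close> the query budget is 0 because \<open>log 2 1 = 0\<close>. The
  grid is then a single point, so every function is Lipschitz and accepting at once is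
  correct.\<close>

lemma one_point_tester:
  assumes \<epsilon>: "0 < \<epsilon>" and c: "c > 0"
  shows "one_sided_lipschitz_tester n 1 c R \<epsilon> (return_pmf (Stop True))"
  unfolding one_sided_lipschitz_tester_def
proof (intro ballI conjI impI)
  fix f assume f: "f \<in> grid n 1 \<rightarrow> R"
  have "x = y" if "x \<in> grid n 1" "y \<in> grid n 1" for x y
    using that PiE_ext[of x "{1..n}" "\<lambda>_. {1..1}" y] unfolding grid_def by fastforce
  then have "c_lipschitz n 1 c f"
    unfolding c_lipschitz_def using c by (metis abs_zero diff_self l1_dist_nonneg less_imp_le mult_nonneg_nonneg)
  then have "lipschitz_distance n 1 c R f \<le> real (card {x \<in> grid n 1. f x \<noteq> f x}) / real 1 ^ n"
    unfolding lipschitz_distance_def using f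
    by (intro Min_le finite_lipschitz_distance_values image_eqI[of _ _ f]) simp_all
  then show "measure_pmf.prob (return_pmf (Stop True)) {A. \<not> accepts A f} > 2 / 3"
    if "lipschitz_distance n 1 c R f > \<epsilon>" using that \<epsilon> by simp
qed (auto simp: measure_return_pmf)

theorem theorem1p4:
  "\<exists>C > 0. \<forall>(n::nat) (k::nat) (\<epsilon>::real) (c::real) (R::real set).
     n \<ge> 1 \<longrightarrow> k \<ge> 1 \<longrightarrow> 0 < \<epsilon> \<longrightarrow> \<epsilon> < 1 \<longrightarrow> c > 0 \<longrightarrow>
     (\<exists>T. one_sided_lipschitz_tester n k c R \<epsilon> T \<and> non_adaptive T \<and>
          makes_at_most_queries n k R T (C * (real n * log 2 (real k) / \<epsilon>)))"
proof (intro exI[of _ 132] conjI allI impI)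
  fix n k :: nat and \<epsilon> c :: real and R :: "real set"
  assume n: "n \<ge> 1" and k: "k \<ge> 1" and \<epsilon>: "0 < \<epsilon>" "\<epsilon> < 1" and c: "c > 0"
  show "\<exists>T. one_sided_lipschitz_tester n k c R \<epsilon> T \<and> non_adaptive T \<and>
          makes_at_most_queries n k R T (132 * (real n * log 2 (real k) / \<epsilon>))"
  proof (cases "k = 1")
    case True
    have "non_adaptive (return_pmf (Stop True))"
      by (simp add: non_adaptive_def)
    moreover have "makes_at_most_queries n k R (return_pmf (Stop True)) (132 * (real n * log 2 (real k) / \<epsilon>))"
      by (simp add: makes_at_most_queries_def True)
    ultimately show ?thesis
      using one_point_tester[OF \<epsilon>(1) c] True by blast
  next
    case False
    with k have k2: "k \<ge> 2" by simp
    define N where "N = nat \<lceil>32 * real n / \<epsilon>\<rceil>"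
    have pos: "32 * real n / \<epsilon> \<ge> 0" using \<epsilon> by simp
    have N: "real N \<ge> 32 * real n / \<epsilon>"
      unfolding N_def by (rule real_nat_ceiling_ge)
    have "1 \<le> real n / \<epsilon>" using n \<epsilon> by (simp add: field_simps)
    moreover have "real N \<le> 32 * real n / \<epsilon> + 1"
      unfolding N_def using pos by linarith
    ultimately have N_le: "real N \<le> 33 * (real n / \<epsilon>)" by simp
    have "real (length (queries A f)) \<le> 132 * (real n * log 2 (real k) / \<epsilon>)"
      if A: "A \<in> set_pmf (line_tester n k c R N)" for A f
    proof -
      obtain ss where ss: "A = sample_algorithm n k c R ss" "length ss = N"
        using A unfolding set_line_tester[OF n k] by (auto simp: sample_lists_def)
      have "real (length (queries A f)) \<le> real (N * (2 * levels k))"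
        using length_queries_sample_algorithm[of n k c R ss f] ss by (simp only: of_nat_le_iff)
      also have "\<dots> = real N * (2 * real (levels k))" by simp
      \<comment> \<open>33 is 32 plus 1 for rounding up, as \<open>1 \<le> n / \<epsilon>\<close>.
        Two probes per level and \<open>levels k \<le> 2 * log 2 k\<close> bring it to 132.\<close>
      also have "\<dots> \<le> (33 * (real n / \<epsilon>)) * (2 * (2 * log 2 (real k)))"
        using levels_le_log[OF k2] N_le \<epsilon> by (intro mult_mono) auto
      finally show ?thesis by (simp add: field_simps)
    qed
    then have "makes_at_most_queries n k R (line_tester n k c R N) (132 * (real n * log 2 (real k) / \<epsilon>))"
      by (simp add: makes_at_most_queries_def)
    moreover have "non_adaptive (line_tester n k c R N)"
      unfolding non_adaptive_def set_line_tester[OF n k] by (auto simp: queries_sample_algorithm)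
    ultimately show ?thesis
      using line_tester_correct[OF n k c \<epsilon>(1) N] by blast
  qed
qed simp

end
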